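(* There exist absolute constants $c>0$ and $n_0\in\mathbb{N}$ such that for every $n\geq n_0$ and all centered log-concave probability measures $\mu,\nu$ on $\mathbb{R}^n$ with densities satisfying $\|f_\mu\|_\infty=\|f_\nu\|_\infty$, $$\int_{\mathbb{R}^n}\varphi_{\mu}(x)\,d\nu(x)\leq \exp\left(-cn/L_{\mu}^2\right).$$
   Context: A log-concave probability measure on $\mathbb{R}^n$ is a Borel probability measure $\mu$ such that $\mu(\lambda A+(1-\lambda)B)\geq \mu(A)^{\lambda}\mu(B)^{1-\lambda}$ for all compact $A,B$ and $\lambda\in(0,1)$, and $\mu(H)<1$ for every hyperplane $H$; it has a log-concave density $f_\mu$. Centered means barycenter at the origin. $\varphi_\mu(x)=\inf\{\mu(H): H$ a half-space containing $x\}$ (Tukey's half-space depth). $L_\mu=\|f_\mu\|_\infty^{1/n}[\det\mathrm{Cov}(\mu)]^{1/(2n)}$. *)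

theory Defs
  imports "HOL-Probability.Probability" "Jordan_Normal_Form.Determinant"
begin

text \<open>Points of R^n are modelled as extensional functions nat => real on the
index set {..<n} (value undefined outside). The ambient Lebesgue measure is the
product measure of n copies of lborel.\<close>

abbreviation Rn :: "nat \<Rightarrow> (nat \<Rightarrow> real) set" where
  "Rn n \<equiv> PiE {..<n} (\<lambda>_. UNIV)"

abbreviation leb :: "nat \<Rightarrow> (nat \<Rightarrow> real) measure" where
  "leb n \<equiv> PiM {..<n} (\<lambda>_. lborel)"

definition ip :: "nat \<Rightarrow> (nat \<Rightarrow> real) \<Rightarrow> (nat \<Rightarrow> real) \<Rightarrow> real" where
  "ip n u v = (\<Sum>i<n. u i * v i)"

definition mink :: "nat \<Rightarrow> real \<Rightarrow> (nat \<Rightarrow> real) set \<Rightarrow> (nat \<Rightarrow> real) set \<Rightarrow> (nat \<Rightarrow> real) set" where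
  "mink n l A B = {restrict (\<lambda>i. l * a i + (1 - l) * b i) {..<n} | a b. a \<in> A \<and> b \<in> B}"

definition hyperplanes :: "nat \<Rightarrow> (nat \<Rightarrow> real) set set" where
  "hyperplanes n = {{y \<in> Rn n. ip n \<theta> y = t} | \<theta> t. \<theta> \<in> Rn n \<and> (\<exists>i<n. \<theta> i \<noteq> 0)}"

definition halfspaces :: "nat \<Rightarrow> (nat \<Rightarrow> real) set set" where
  "halfspaces n = {{y \<in> Rn n. ip n \<theta> y \<ge> t} | \<theta> t. \<theta> \<in> Rn n \<and> (\<exists>i<n. \<theta> i \<noteq> 0)}"

definition log_concave :: "nat \<Rightarrow> (nat \<Rightarrow> real) measure \<Rightarrow> bool" where
  "log_concave n \<mu> \<longleftrightarrow>
     prob_space \<mu> \<and> sets \<mu> = sets (leb n) \<and>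
     (\<forall>A B l. compact A \<and> compact B \<and> A \<subseteq> Rn n \<and> B \<subseteq> Rn n \<and> 0 < l \<and> l < 1 \<longrightarrow>
        measure \<mu> (mink n l A B) \<ge> measure \<mu> A powr l * measure \<mu> B powr (1 - l)) \<and>
     (\<forall>H \<in> hyperplanes n. measure \<mu> H < 1)"

definition centered :: "nat \<Rightarrow> (nat \<Rightarrow> real) measure \<Rightarrow> bool" where
  "centered n \<mu> \<longleftrightarrow> (\<forall>i<n. integrable \<mu> (\<lambda>x. x i) \<and> (\<integral>x. x i \<partial>\<mu>) = 0)"

definition dens_sup :: "nat \<Rightarrow> (nat \<Rightarrow> real) measure \<Rightarrow> real" where
  "dens_sup n \<mu> = enn2real (esssup (leb n) (RN_deriv (leb n) \<mu>))"

definition barycenter :: "(nat \<Rightarrow> real) measure \<Rightarrow> nat \<Rightarrow> real" where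
  "barycenter \<mu> i = (\<integral>x. x i \<partial>\<mu>)"

definition cov_mat :: "nat \<Rightarrow> (nat \<Rightarrow> real) measure \<Rightarrow> real mat" where
  "cov_mat n \<mu> = mat n n (\<lambda>(i, j).
      \<integral>x. (x i - barycenter \<mu> i) * (x j - barycenter \<mu> j) \<partial>\<mu>)"

definition iso_const :: "nat \<Rightarrow> (nat \<Rightarrow> real) measure \<Rightarrow> real" where
  "iso_const n \<mu> = dens_sup n \<mu> powr (1 / real n) * det (cov_mat n \<mu>) powr (1 / (2 * real n))"

definition depth :: "nat \<Rightarrow> (nat \<Rightarrow> real) measure \<Rightarrow> (nat \<Rightarrow> real) \<Rightarrow> real" where
  "depth n \<mu> x = Inf {measure \<mu> H | H. H \<in> halfspaces n \<and> x \<in> H}"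

end

theory Submission
  imports Defs
begin

text \<open>
  Let S be a sum of N independent copies of a random vector X with law \<mu> (slightly smoothed by a
  uniform variable on a small cube, so that the log-concavity of \<mu> on cubes is the pointwise
  log-concavity of a continuous density). If N copies of X lie in a half-space then so does
  their average, hence the depth of \<mu> at x is at most twice the N-th root of the depth of S at N x.

  By the Prekopa-Leindler inequality S has a log-concave density g. If K is the level set on which g
  is at least exp (-4 n) times its value at some point x0, then midpoint log-concavity bounds the
  probability of the complement of K by exp (-n), and the volume of K is at most exp (4 n) / g x0.
  Since K is closed and convex, points outside K are separated from K by a half-space, so their depth
  with respect to S is at most exp (-n). Comparing g with a Gaussian gives a point x0 with g x0 at least
  of order (c / N) ^ (n / 2) / sqrt (det Cov). Rescaling by N shows that the depth of \<mu> is at most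
  2 exp (-n / N) off a set of volume (C / N) ^ (n / 2) sqrt (det Cov), whose \<nu>-measure is at most
  (C L^2 / N) ^ (n / 2). Choosing N of order L^2 finishes the proof.
\<close>

section \<open>Prekopa-Leindler inequality\<close>

text \<open>Why sums help: one copy gives a level set of volume about (C L)^n / M, where M bounds
  both densities, so its \<nu>-mass is only bounded by (C L)^n, which is useless. With N copies,
  variances add linearly and the density at x0 loses only a factor N^(n/2), whereas passing from
  sums to averages divides volumes by N^n. The net gain N^(-n/2) beats (C L)^n once N is of order
  L^2. The price is an N-th root, which weakens exp(-n) to exp(-n/N); this is the source of 1/L^2 in
  the exponent.

  The obstacle is that log-concavity is given through masses of compact sets, while level sets and
  separation need a density with good values at every point. The normalized mass of a small cube
  around z is both at once: a mass, and the density at z of the law smoothed by a uniform variable.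
  Smoothing costs a factor 2 per copy, and its variance is as small as desired.

  Copies are made by repeated self-convolution, so N is a power of two; rounding costs one more
  constant factor.\<close>

lemma brunn_minkowski_1d:
  fixes A B C :: "real set" and l :: real
  assumes meas: "A \<in> sets borel" "B \<in> sets borel" "C \<in> sets borel"
    and ne: "A \<noteq> {}" "B \<noteq> {}" and bdd: "bdd_above A" "bdd_below B"
    and l: "0 < l" "l < 1"
    and sub: "\<And>a b. a \<in> A \<Longrightarrow> b \<in> B \<Longrightarrow> l * a + (1 - l) * b \<in> C"
  shows "ennreal l * emeasure lborel A + ennreal (1 - l) * emeasure lborel B \<le> emeasure lborel C"
proof (rule ennreal_le_epsilon)
  fix e :: real assume e: "0 < e"
  obtain a where a: "a \<in> A" "Sup A - e < a"
    using less_cSupD[OF ne(1), of "Sup A - e"] e by auto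
  obtain b where b: "b \<in> B" "b < Inf B + e"
    using cInf_lessD[OF ne(2), of "Inf B + e"] e by auto
  \<comment> \<open>\<open>C\<close> contains \<open>l * A\<close> shifted by
    \<open>(1 - l) * b\<close>, which lies to the left of \<open>p\<close>, and
    \<open>(1 - l) * B\<close> shifted by \<open>l * a\<close>, which lies to the right of
    \<open>q\<close>. As \<open>a\<close> is near the top of \<open>A\<close> and \<open>b\<close>
    near the bottom of \<open>B\<close>, the two pieces overlap in length at most
    \<open>e\<close>.\<close>
  define p where "p = l * Sup A + (1 - l) * b"
  define q where "q = l * a + (1 - l) * Inf B"
  have scale: "ennreal c * emeasure lborel E \<le> emeasure lborel D"
    if "E \<in> sets borel" "D \<in> sets borel" "c > 0" "\<And>x. x \<in> E \<Longrightarrow> t + c * x \<in> D"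
    for E D :: "real set" and c t :: real
  proof -
    have [measurable]: "E \<in> sets borel" "D \<in> sets borel" using that by auto
    have "emeasure lborel D = (\<integral>\<^sup>+x. indicator D x \<partial>lborel)" by simp
    also have "\<dots> = ennreal c * (\<integral>\<^sup>+x. indicator D (t + c * x) \<partial>lborel)"
      using that by (subst nn_integral_real_affine[of _ c t]) auto
    finally have eq: "emeasure lborel D = ennreal c * (\<integral>\<^sup>+x. indicator D (t + c * x) \<partial>lborel)" .
    have "emeasure lborel E = (\<integral>\<^sup>+x. indicator E x \<partial>lborel)" by simp
    also have "\<dots> \<le> (\<integral>\<^sup>+x. indicator D (t + c * x) \<partial>lborel)"
      using that by (intro nn_integral_mono) (auto simp: indicator_def)
    finally show ?thesis unfolding eq by (rule mult_left_mono) simp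
  qed
  have 1: "ennreal l * emeasure lborel A \<le> emeasure lborel (C \<inter> {..p})"
    using l meas sub[OF _ b(1)] cSup_upper[OF _ bdd(1)]
    by (intro scale[where t = "(1 - l) * b"]) (auto simp: p_def add.commute)
  have 2: "ennreal (1 - l) * emeasure lborel B \<le> emeasure lborel (C \<inter> {q..})"
    using l meas sub[OF a(1)] cInf_lower[OF _ bdd(2)]
    by (intro scale[where t = "l * a"]) (auto simp: q_def)
  have "l * (Sup A - a) + (1 - l) * (b - Inf B) \<le> l * e + (1 - l) * e"
    using l a b by (intro add_mono mult_left_mono) auto
  then have pq: "p - q \<le> e" by (simp add: p_def q_def algebra_simps)
  have "ennreal l * emeasure lborel A + ennreal (1 - l) * emeasure lborel B
      \<le> emeasure lborel (C \<inter> {..p}) + emeasure lborel (C \<inter> {q..})"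
    using 1 2 by (rule add_mono)
  also have "\<dots> = emeasure lborel (C \<inter> {..p} \<union> C \<inter> {q..}) + emeasure lborel (C \<inter> {..p} \<inter> (C \<inter> {q..}))"
    using meas by (intro emeasure_Un_Int) auto
  also have "\<dots> \<le> emeasure lborel C + emeasure lborel {q..p}"
    using meas by (intro add_mono emeasure_mono) auto
  also have "emeasure lborel {q..p} \<le> ennreal e"
    using pq e by (cases "q \<le> p") (auto intro: ennreal_leI)
  finally show "ennreal l * emeasure lborel A + ennreal (1 - l) * emeasure lborel B
      \<le> emeasure lborel C + ennreal e" by (simp add: add_left_mono)
qed

lemma nn_integral_layer_cake:
  fixes f :: "real \<Rightarrow> real"
  assumes [measurable]: "f \<in> borel_measurable borel"
  shows "(\<integral>\<^sup>+x. ennreal (f x) \<partial>lborel) =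
         (\<integral>\<^sup>+s. indicator {0<..} s * emeasure lborel {x. s < f x} \<partial>lborel)"
proof -
  have seg: "ennreal r = (\<integral>\<^sup>+s. indicator {0<..<r} s \<partial>lborel)" for r :: real
    by (cases "0 \<le> r") (auto simp: ennreal_neg)
  have "(\<integral>\<^sup>+x. ennreal (f x) \<partial>lborel)
      = (\<integral>\<^sup>+x. (\<integral>\<^sup>+s. indicator {0<..} s * indicator {z. snd z < f (fst z)} (x, s) \<partial>lborel) \<partial>lborel)"
    unfolding seg by (intro nn_integral_cong) (auto simp: indicator_def)
  also have "\<dots> = (\<integral>\<^sup>+s. (\<integral>\<^sup>+x. indicator {0<..} s * indicator {z. snd z < f (fst z)} (x, s) \<partial>lborel) \<partial>lborel)"
    by (rule lborel_pair.Fubini'[symmetric]) measurable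
  also have "\<dots> = (\<integral>\<^sup>+s. indicator {0<..} s * emeasure lborel {x. s < f x} \<partial>lborel)"
  proof (intro nn_integral_cong)
    fix s :: real
    have "(\<integral>\<^sup>+x. indicator {0<..} s * indicator {z. snd z < f (fst z)} (x, s) \<partial>lborel)
       = indicator {0<..} s * (\<integral>\<^sup>+x. indicator {x. s < f x} x \<partial>lborel)"
      by (subst nn_integral_cmult[symmetric]) (auto intro!: nn_integral_cong simp: indicator_def)
    then show "(\<integral>\<^sup>+x. indicator {0<..} s * indicator {z. snd z < f (fst z)} (x, s) \<partial>lborel)
       = indicator {0<..} s * emeasure lborel {x. s < f x}" by simp
  qed
  finally show ?thesis .
qed

text \<open>With both suprema equal to 1, the level sets of \<open>f\<close> and \<open>g\<close> at
  a height between 0 and 1 are nonempty simultaneously, so Brunn-Minkowski applies height by height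
  and the layer cake formula integrates the result. The normalization yields an arithmetic mean,
  which is stronger than the geometric one.\<close>

lemma prekopa_leindler_1d_normalized:
  fixes f g h :: "real \<Rightarrow> real" and l R :: real
  assumes [measurable]: "f \<in> borel_measurable borel" "g \<in> borel_measurable borel" "h \<in> borel_measurable borel"
    and l: "0 < l" "l < 1"
    and le1: "\<And>x. f x \<le> 1" "\<And>x. g x \<le> 1"
    and sup1: "\<And>s. s < 1 \<Longrightarrow> \<exists>x. s < f x" "\<And>s. s < 1 \<Longrightarrow> \<exists>x. s < g x"
    and supp: "\<And>x. R < \<bar>x\<bar> \<Longrightarrow> f x = 0" "\<And>x. R < \<bar>x\<bar> \<Longrightarrow> g x = 0"
    and h: "\<And>x y. f x powr l * g y powr (1 - l) \<le> h (l * x + (1 - l) * y)"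
  shows "ennreal l * (\<integral>\<^sup>+x. f x \<partial>lborel) + ennreal (1 - l) * (\<integral>\<^sup>+x. g x \<partial>lborel) \<le> (\<integral>\<^sup>+x. h x \<partial>lborel)"
proof -
  have level: "indicator {0<..} s * (ennreal l * emeasure lborel {x. s < f x} + ennreal (1 - l) * emeasure lborel {x. s < g x})
      \<le> indicator {0<..} s * emeasure lborel {x. s < h x}" for s :: real
  proof (cases "0 < s \<and> s < 1")
    case True
    have "ennreal l * emeasure lborel {x. s < f x} + ennreal (1 - l) * emeasure lborel {x. s < g x}
        \<le> emeasure lborel {x. s < h x}"
    proof (rule brunn_minkowski_1d)
      have *: "- R \<le> x \<and> x \<le> R" if "s < f x \<or> s < g x" for x
        using supp[of x] that True by (cases "R < \<bar>x\<bar>") auto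
      show "bdd_above {x. s < f x}" using * by (auto intro!: bdd_aboveI[of _ R])
      show "bdd_below {x. s < g x}" using * by (auto intro!: bdd_belowI[of _ "-R"])
      show "l * a + (1 - l) * b \<in> {x. s < h x}" if "a \<in> {x. s < f x}" "b \<in> {x. s < g x}" for a b
      proof -
        have "s = s powr l * s powr (1 - l)" using True by (simp flip: powr_add)
        also have "\<dots> < f a powr l * g b powr (1 - l)"
          using that True l by (intro mult_strict_mono powr_less_mono2) auto
        also have "\<dots> \<le> h (l * a + (1 - l) * b)" by (rule h)
        finally show ?thesis by simp
      qed
    qed (use l True sup1 in auto)
    then show ?thesis using True by (simp add: mult_left_mono)
  next
    case False
    then consider "s \<le> 0" | "1 \<le> s" by linarith
    then show ?thesis
    proof cases
      case 2
      then have "{x. s < f x} = {}" "{x. s < g x} = {}"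
        using le1 by (auto simp: not_less intro: order_trans)
      then show ?thesis by simp
    qed simp
  qed
  have [measurable]: "(\<lambda>s. emeasure lborel {x. s < k x}) \<in> borel_measurable borel"
    if [measurable]: "k \<in> borel_measurable borel" for k :: "real \<Rightarrow> real"
  proof -
    have "(\<lambda>s. \<integral>\<^sup>+x. indicator {z. fst z < k (snd z)} (s, x) \<partial>lborel) \<in> borel_measurable borel"
      by measurable
    moreover have "(\<lambda>s. \<integral>\<^sup>+x. indicator {z. fst z < k (snd z)} (s, x) \<partial>lborel) = (\<lambda>s. emeasure lborel {x. s < k x})"
      by (auto simp: nn_integral_indicator[symmetric] indicator_def simp del: nn_integral_indicator intro!: nn_integral_cong)
    ultimately show ?thesis by simp
  qed
  have "ennreal l * (\<integral>\<^sup>+x. f x \<partial>lborel) + ennreal (1 - l) * (\<integral>\<^sup>+x. g x \<partial>lborel)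
    = (\<integral>\<^sup>+s. indicator {0<..} s * (ennreal l * emeasure lborel {x. s < f x} + ennreal (1 - l) * emeasure lborel {x. s < g x}) \<partial>lborel)"
    by (simp add: nn_integral_layer_cake nn_integral_cmult[symmetric] nn_integral_add[symmetric] algebra_simps)
  also have "\<dots> \<le> (\<integral>\<^sup>+s. indicator {0<..} s * emeasure lborel {x. s < h x} \<partial>lborel)"
    by (intro nn_integral_mono level)
  also have "\<dots> = (\<integral>\<^sup>+x. h x \<partial>lborel)"
    by (simp add: nn_integral_layer_cake)
  finally show ?thesis .
qed

lemma young_powr:
  fixes a b l :: real
  assumes "0 \<le> a" "0 \<le> b" "0 < l" "l < 1"
  shows "a powr l * b powr (1 - l) \<le> l * a + (1 - l) * b"
proof (cases "a = 0 \<or> b = 0")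
  case True
  then show ?thesis using assms by auto
next
  case False
  then show ?thesis using assms by (intro Youngs_inequality_0) auto
qed

lemma prekopa_leindler_1d:
  fixes f g h :: "real \<Rightarrow> real" and l R B :: real
  assumes int: "integrable lborel f" "integrable lborel g" "integrable lborel h"
    and l: "0 < l" "l < 1"
    and nonneg: "\<And>x. 0 \<le> f x" "\<And>x. 0 \<le> g x" "\<And>x. 0 \<le> h x"
    and bound: "\<And>x. f x \<le> B" "\<And>x. g x \<le> B"
    and supp: "\<And>x. R < \<bar>x\<bar> \<Longrightarrow> f x = 0" "\<And>x. R < \<bar>x\<bar> \<Longrightarrow> g x = 0"
    and h: "\<And>x y. f x powr l * g y powr (1 - l) \<le> h (l * x + (1 - l) * y)"
  shows "(\<integral>x. f x \<partial>lborel) powr l * (\<integral>x. g x \<partial>lborel) powr (1 - l) \<le> (\<integral>x. h x \<partial>lborel)"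
proof -
  have [measurable]: "f \<in> borel_measurable borel" "g \<in> borel_measurable borel" "h \<in> borel_measurable borel"
    using int by (auto dest: borel_measurable_integrable)
  have bdd: "bdd_above (range f)" "bdd_above (range g)" using bound by (auto intro!: bdd_aboveI[of _ B])
  define a where "a = Sup (range f)"
  define b where "b = Sup (range g)"
  have fa: "f x \<le> a" and gb: "g x \<le> b" for x
    using bdd by (auto simp: a_def b_def intro!: cSup_upper)
  have ab: "0 \<le> a" "0 \<le> b" using fa[of 0] gb[of 0] nonneg[of 0] by auto
  have h0: "0 \<le> (\<integral>x. h x \<partial>lborel)" using nonneg by simp
  show ?thesis
  proof (cases "a = 0 \<or> b = 0")
    case True
    then have "(\<forall>x. f x = 0) \<or> (\<forall>x. g x = 0)" using fa gb nonneg by (metis order_antisym)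
    then show ?thesis using h0 by auto
  next
    case False
    then have ab: "0 < a" "0 < b" using ab by auto
    \<comment> \<open>The hypothesis is homogeneous: dividing \<open>f\<close> by \<open>a\<close>
      and \<open>g\<close> by \<open>b\<close> amounts to dividing \<open>h\<close> by
      \<open>c\<close>. Young's inequality afterwards turns the arithmetic mean back into the
      product.\<close>
    define c where "c = a powr l * b powr (1 - l)"
    have c: "0 < c" using ab by (simp add: c_def)
    have "ennreal l * (\<integral>\<^sup>+x. f x / a \<partial>lborel) + ennreal (1 - l) * (\<integral>\<^sup>+x. g x / b \<partial>lborel) \<le> (\<integral>\<^sup>+x. h x / c \<partial>lborel)"
    proof (rule prekopa_leindler_1d_normalized[where R = R])
      show "\<exists>x. s < f x / a" if "s < 1" for s
      proof -
        have "s * a < a" using that ab by simp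
        then obtain x where "s * a < f x"
          using less_cSupD[of "range f" "s * a"] by (auto simp: a_def)
        then show ?thesis using ab by (auto simp: field_simps)
      qed
      show "\<exists>x. s < g x / b" if "s < 1" for s
      proof -
        have "s * b < b" using that ab by simp
        then obtain x where "s * b < g x"
          using less_cSupD[of "range g" "s * b"] by (auto simp: b_def)
        then show ?thesis using ab by (auto simp: field_simps)
      qed
      show "(f x / a) powr l * (g y / b) powr (1 - l) \<le> h (l * x + (1 - l) * y) / c" for x y
      proof -
        have "(f x / a) powr l * (g y / b) powr (1 - l) = f x powr l * g y powr (1 - l) / c"
          using nonneg ab by (simp add: powr_divide c_def)
        then show ?thesis using h[of x y] c by (simp add: divide_right_mono)
      qed
    qed (use l ab fa gb supp in \<open>auto simp: field_simps\<close>)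
    also have "(\<integral>\<^sup>+x. f x / a \<partial>lborel) = ennreal ((\<integral>x. f x \<partial>lborel) / a)"
      using int nonneg ab by (subst nn_integral_eq_integral) auto
    also have "(\<integral>\<^sup>+x. g x / b \<partial>lborel) = ennreal ((\<integral>x. g x \<partial>lborel) / b)"
      using int nonneg ab by (subst nn_integral_eq_integral) auto
    also have "(\<integral>\<^sup>+x. h x / c \<partial>lborel) = ennreal ((\<integral>x. h x \<partial>lborel) / c)"
      using int nonneg c by (subst nn_integral_eq_integral) auto
    finally have "l * ((\<integral>x. f x \<partial>lborel) / a) + (1 - l) * ((\<integral>x. g x \<partial>lborel) / b) \<le> (\<integral>x. h x \<partial>lborel) / c"
      using l ab c nonneg h0 by (simp flip: ennreal_mult' ennreal_plus)
    moreover have "((\<integral>x. f x \<partial>lborel) / a) powr l * ((\<integral>x. g x \<partial>lborel) / b) powr (1 - l)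
        \<le> l * ((\<integral>x. f x \<partial>lborel) / a) + (1 - l) * ((\<integral>x. g x \<partial>lborel) / b)"
      using l ab nonneg by (intro young_powr) auto
    moreover have "((\<integral>x. f x \<partial>lborel) / a) powr l * ((\<integral>x. g x \<partial>lborel) / b) powr (1 - l)
        = (\<integral>x. f x \<partial>lborel) powr l * (\<integral>x. g x \<partial>lborel) powr (1 - l) / c"
      using nonneg ab by (simp add: powr_divide c_def)
    ultimately have "(\<integral>x. f x \<partial>lborel) powr l * (\<integral>x. g x \<partial>lborel) powr (1 - l) / c \<le> (\<integral>x. h x \<partial>lborel) / c"
      by linarith
    then show ?thesis using c by (simp add: divide_le_cancel)
  qed
qed

section \<open>Prekopa-Leindler in dimension n, by induction over the coordinates\<close>

definition cmb :: "nat \<Rightarrow> real \<Rightarrow> (nat \<Rightarrow> real) \<Rightarrow> (nat \<Rightarrow> real) \<Rightarrow> (nat \<Rightarrow> real)" where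
  "cmb n l x y = restrict (\<lambda>i. l * x i + (1 - l) * y i) {..<n}"

interpretation lebs: product_sigma_finite "\<lambda>_::nat. lborel :: real measure" ..

lemma leb_Suc: "leb (Suc n) = PiM (insert n {..<n}) (\<lambda>_. lborel)"
  by (simp add: lessThan_Suc)

lemma space_leb: "space (leb n) = Rn n"
  by (simp add: space_PiM)

lemma cmb_in_Rn [simp]: "cmb n l x y \<in> Rn n"
  by (simp add: cmb_def)

lemma cmb_nth [simp]: "i < n \<Longrightarrow> cmb n l x y i = l * x i + (1 - l) * y i"
  by (simp add: cmb_def)

lemma upd_in_Rn: "x \<in> Rn n \<Longrightarrow> x(n := s) \<in> Rn (Suc n)"
  by (auto simp: PiE_iff extensional_def)

lemma cmb_upd: "cmb (Suc n) l (x(n := s)) (y(n := t)) = (cmb n l x y)(n := l * s + (1 - l) * t)"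
  by (auto simp: cmb_def fun_eq_iff less_Suc_eq)

definition cube :: "nat \<Rightarrow> (nat \<Rightarrow> real) \<Rightarrow> real \<Rightarrow> (nat \<Rightarrow> real) set" where
  "cube n x r = PiE {..<n} (\<lambda>i. {x i - r..x i + r})"

lemma cube_iff: "y \<in> cube n x r \<longleftrightarrow> y \<in> Rn n \<and> (\<forall>i<n. \<bar>y i - x i\<bar> \<le> r)"
  by (auto simp: cube_def PiE_iff abs_le_iff algebra_simps Ball_def)

lemma cube_sets [measurable]: "cube n x r \<in> sets (leb n)"
  unfolding cube_def by (intro sets_PiM_I_finite) auto

lemma emeasure_cube: "0 \<le> r \<Longrightarrow> emeasure (leb n) (cube n x r) = ennreal ((2 * r) ^ n)"
  unfolding cube_def by (subst lebs.emeasure_PiM) (auto simp: ennreal_power)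

lemma measurable_leb_upd [measurable]:
  assumes "f \<in> borel_measurable (leb (Suc n))"
  shows "(\<lambda>(x, s). f (x(n := s))) \<in> borel_measurable (leb n \<Otimes>\<^sub>M lborel)"
proof -
  have "(\<lambda>(x, s). x(n := s)) \<in> leb n \<Otimes>\<^sub>M lborel \<rightarrow>\<^sub>M leb (Suc n)"
    unfolding leb_Suc by (rule measurable_add_dim)
  from measurable_compose[OF this assms] show ?thesis by (simp add: case_prod_beta')
qed

lemma measurable_leb_upd_section:
  assumes "f \<in> borel_measurable (leb (Suc n))" "x \<in> Rn n"
  shows "(\<lambda>s. f (x(n := s))) \<in> borel_measurable lborel"
  using measurable_Pair2[OF measurable_leb_upd[OF assms(1)], of x] assms(2) by (simp add: space_leb)

lemma integrable_bounded_box: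
  fixes f :: "(nat \<Rightarrow> real) \<Rightarrow> real"
  assumes [measurable]: "f \<in> borel_measurable (leb n)" and "0 \<le> R"
    and "\<And>x. x \<in> Rn n \<Longrightarrow> 0 \<le> f x \<and> f x \<le> B" "\<And>x. x \<in> Rn n \<Longrightarrow> x \<notin> cube n (\<lambda>_. 0) R \<Longrightarrow> f x = 0"
  shows "integrable (leb n) f"
proof (rule Bochner_Integration.integrable_bound)
  show "integrable (leb n) (\<lambda>x. B * indicator (cube n (\<lambda>_. 0) R) x)"
    using emeasure_cube[OF \<open>0 \<le> R\<close>, of n "\<lambda>_. 0"] by (intro integrable_mult_right) (auto simp: integrable_indicator_iff)
  show "AE x in leb n. norm (f x) \<le> norm (B * indicator (cube n (\<lambda>_. 0) R) x)"
  proof (rule AE_I2)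
    fix x assume "x \<in> space (leb n)"
    then have "x \<in> Rn n" by (simp add: space_leb)
    from assms(3,4)[OF this] show "norm (f x) \<le> norm (B * indicator (cube n (\<lambda>_. 0) R) x)"
      by (cases "x \<in> cube n (\<lambda>_. 0) R") auto
  qed
qed simp

text \<open>Induction on the dimension: the one-dimensional inequality on the fibres of the last
  coordinate is exactly the hypothesis needed for the fibre integrals. Boundedness and support in a
  box are carried along so that every fibre, not only almost every one, is integrable.\<close>

lemma prekopa_leindler_box:
  fixes f g h :: "(nat \<Rightarrow> real) \<Rightarrow> real"
  assumes "f \<in> borel_measurable (leb n)" "g \<in> borel_measurable (leb n)" "h \<in> borel_measurable (leb n)"
    and l: "0 < l" "l < 1" and R: "0 \<le> R"
    and "\<And>x. x \<in> Rn n \<Longrightarrow> 0 \<le> f x \<and> f x \<le> B" "\<And>x. x \<in> Rn n \<Longrightarrow> 0 \<le> g x \<and> g x \<le> B" "\<And>x. x \<in> Rn n \<Longrightarrow> 0 \<le> h x \<and> h x \<le> B"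
    and "\<And>x. x \<in> Rn n \<Longrightarrow> x \<notin> cube n (\<lambda>_. 0) R \<Longrightarrow> f x = 0"
    and "\<And>x. x \<in> Rn n \<Longrightarrow> x \<notin> cube n (\<lambda>_. 0) R \<Longrightarrow> g x = 0"
    and "\<And>x. x \<in> Rn n \<Longrightarrow> x \<notin> cube n (\<lambda>_. 0) R \<Longrightarrow> h x = 0"
    and "\<And>x y. x \<in> Rn n \<Longrightarrow> y \<in> Rn n \<Longrightarrow> f x powr l * g y powr (1 - l) \<le> h (cmb n l x y)"
  shows "(\<integral>x. f x \<partial>leb n) powr l * (\<integral>x. g x \<partial>leb n) powr (1 - l) \<le> (\<integral>x. h x \<partial>leb n)"
  using assms(1-3,7-)
proof (induction n arbitrary: f g h B)
  case 0
  \<comment> \<open>In dimension 0 the only point is the everywhere undefined function, and it has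
    mass 1.\<close>
  define u where "u = (\<lambda>_::nat. undefined :: real)"
  have eq: "(\<integral>x. k x \<partial>leb 0) = k u" for k :: "(nat \<Rightarrow> real) \<Rightarrow> real"
    by (simp add: u_def PiM_empty lebesgue_integral_count_space_finite)
  have "u \<in> Rn 0" "cmb 0 l u u = u" by (auto simp: u_def cmb_def fun_eq_iff)
  then show ?case unfolding eq using 0(10)[of u u] by simp
next
  case (Suc n)
  define I where "I k x = (\<integral>s. k (x(n := s)) \<partial>lborel)" for k :: "(nat \<Rightarrow> real) \<Rightarrow> real" and x :: "nat \<Rightarrow> real"
  have B: "0 \<le> B"
  proof -
    have "restrict (\<lambda>_. 0) {..<Suc n} \<in> Rn (Suc n)" by simp
    from Suc.prems(4)[OF this] show ?thesis by linarith
  qed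
  have upd_out: "x(n := s) \<notin> cube (Suc n) (\<lambda>_. 0) R" if "x \<in> Rn n" "x \<notin> cube n (\<lambda>_. 0) R \<or> R < \<bar>s\<bar>" for x s
    using that by (fastforce simp: cube_iff less_Suc_eq)
  define adm where "adm k \<longleftrightarrow> k \<in> borel_measurable (leb (Suc n)) \<and> (\<forall>x\<in>Rn (Suc n). 0 \<le> k x \<and> k x \<le> B) \<and>
      (\<forall>x\<in>Rn (Suc n). x \<notin> cube (Suc n) (\<lambda>_. 0) R \<longrightarrow> k x = 0)" for k
  have adm: "adm f" "adm g" "adm h" unfolding adm_def using Suc.prems by blast+
  have sec: "integrable lborel (\<lambda>s. k (x(n := s)))" "I k x \<le> B * (2 * R)" "0 \<le> I k x"
       "x \<notin> cube n (\<lambda>_. 0) R \<Longrightarrow> I k x = 0"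
    if adm: "adm k" and x: "x \<in> Rn n" for k x
  proof -
    have k: "k \<in> borel_measurable (leb (Suc n))" "\<And>x. x \<in> Rn (Suc n) \<Longrightarrow> 0 \<le> k x \<and> k x \<le> B"
      "\<And>x. x \<in> Rn (Suc n) \<Longrightarrow> x \<notin> cube (Suc n) (\<lambda>_. 0) R \<Longrightarrow> k x = 0"
      using adm unfolding adm_def by blast+
    have bnd: "0 \<le> k (x(n := s))" "k (x(n := s)) \<le> B * indicator {-R..R} s" for s
      using k(2)[OF upd_in_Rn[OF x, of s]] k(3)[OF upd_in_Rn[OF x, of s]] upd_out[OF x, of s] B
      by (auto simp: indicator_def not_le abs_if split: if_splits)
    have int: "integrable lborel (\<lambda>s. B * indicator {-R..R} s)"
      using R by (intro integrable_mult_right) (auto simp: integrable_indicator_iff)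
    show 1: "integrable lborel (\<lambda>s. k (x(n := s)))"
      using bnd by (intro Bochner_Integration.integrable_bound[OF int])
        (use measurable_leb_upd_section[OF k(1) x] in \<open>auto intro!: AE_I2\<close>, meson abs_ge_self order_trans)
    have "I k x \<le> (\<integral>s. B * indicator {-R..R} s \<partial>lborel)"
      unfolding I_def using bnd by (intro integral_mono 1 int)
    then show "I k x \<le> B * (2 * R)" using R by simp
    show "0 \<le> I k x" unfolding I_def using bnd by simp
    show "I k x = 0" if "x \<notin> cube n (\<lambda>_. 0) R"
      unfolding I_def using k(3)[OF upd_in_Rn[OF x]] upd_out[OF x] that by simp
  qed
  have meas: "I k \<in> borel_measurable (leb n)" if "k \<in> borel_measurable (leb (Suc n))" for k
    using measurable_leb_upd[OF that] unfolding I_def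
    by (rule sigma_finite_measure.borel_measurable_lebesgue_integral[OF sigma_finite_lborel])
  have fold: "(\<integral>x. k x \<partial>leb (Suc n)) = (\<integral>x. I k x \<partial>leb n)"
    if "adm k" for k
  proof -
    have "integrable (leb (Suc n)) k"
      using that R by (intro integrable_bounded_box[where B = B and R = R]) (auto simp: adm_def)
    then show ?thesis
      unfolding I_def leb_Suc by (intro lebs.product_integral_insert) (auto simp: leb_Suc)
  qed
  note sf = sec[OF adm(1)] and sg = sec[OF adm(2)] and sh = sec[OF adm(3)]
  have main: "I f x powr l * I g y powr (1 - l) \<le> I h (cmb n l x y)" if x: "x \<in> Rn n" "y \<in> Rn n" for x y
    unfolding I_def
  proof (rule prekopa_leindler_1d[where R = R and B = B])
    show "f (x(n := s)) powr l * g (y(n := t)) powr (1 - l) \<le> h ((cmb n l x y)(n := l * s + (1 - l) * t))" for s t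
      using Suc.prems(10)[OF upd_in_Rn[OF x(1)] upd_in_Rn[OF x(2)], of s t] unfolding cmb_upd .
    show "f (x(n := s)) = 0" "g (y(n := s)) = 0" if "R < \<bar>s\<bar>" for s
      using Suc.prems(7)[OF upd_in_Rn[OF x(1)] upd_out[OF x(1)]] Suc.prems(8)[OF upd_in_Rn[OF x(2)] upd_out[OF x(2)]] that
      by blast+
    show "0 \<le> f (x(n := s))" "f (x(n := s)) \<le> B" for s using Suc.prems(4)[OF upd_in_Rn[OF x(1), of s]] by blast+
    show "0 \<le> g (y(n := s))" "g (y(n := s)) \<le> B" for s using Suc.prems(5)[OF upd_in_Rn[OF x(2), of s]] by blast+
    show "0 \<le> h ((cmb n l x y)(n := s))" for s using Suc.prems(6)[OF upd_in_Rn[OF cmb_in_Rn, of n l x y s]] by blast+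
  qed (rule sf(1)[OF x(1)] sg(1)[OF x(2)] sh(1)[OF cmb_in_Rn] l)+
  have "(\<integral>x. I f x \<partial>leb n) powr l * (\<integral>x. I g x \<partial>leb n) powr (1 - l) \<le> (\<integral>x. I h x \<partial>leb n)"
  \<comment> \<open>Fibre integrals run over \<open>{-R..R}\<close>, so the common bound grows by
    the factor \<open>2 * R\<close>; this is why \<open>B\<close> varies in the induction.\<close>
  proof (rule Suc.IH[where B = "B * (2 * R)"])
    show "I f \<in> borel_measurable (leb n)" "I g \<in> borel_measurable (leb n)" "I h \<in> borel_measurable (leb n)"
      by (rule meas, rule Suc.prems)+
  next
    fix x :: "nat \<Rightarrow> real" assume x: "x \<in> Rn n"
    show "0 \<le> I f x \<and> I f x \<le> B * (2 * R)" "0 \<le> I g x \<and> I g x \<le> B * (2 * R)" "0 \<le> I h x \<and> I h x \<le> B * (2 * R)"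
      by (intro conjI sf(2,3)[OF x] sg(2,3)[OF x] sh(2,3)[OF x])+
    show "I f x = 0" "I g x = 0" "I h x = 0" if "x \<notin> cube n (\<lambda>_. 0) R"
      by (rule sf(4)[OF x that] sg(4)[OF x that] sh(4)[OF x that])+
  qed (rule main)
  then show ?case
    using fold adm by simp
qed

text \<open>Cutting all three functions off outside a cube preserves the hypothesis because cubes
  are convex; dominated convergence then removes the cut-off.\<close>

lemma prekopa_leindler:
  fixes f g h :: "(nat \<Rightarrow> real) \<Rightarrow> real"
  assumes int: "integrable (leb n) f" "integrable (leb n) g" "integrable (leb n) h"
    and l: "0 < l" "l < 1"
    and bnd: "\<And>x. x \<in> Rn n \<Longrightarrow> 0 \<le> f x \<and> f x \<le> B" "\<And>x. x \<in> Rn n \<Longrightarrow> 0 \<le> g x \<and> g x \<le> B" "\<And>x. x \<in> Rn n \<Longrightarrow> 0 \<le> h x \<and> h x \<le> B"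
    and h: "\<And>x y. x \<in> Rn n \<Longrightarrow> y \<in> Rn n \<Longrightarrow> f x powr l * g y powr (1 - l) \<le> h (cmb n l x y)"
  shows "(\<integral>x. f x \<partial>leb n) powr l * (\<integral>x. g x \<partial>leb n) powr (1 - l) \<le> (\<integral>x. h x \<partial>leb n)"
proof -
  define cut where "cut k R x = k x * indicator (cube n (\<lambda>_. 0) (real R)) x" for k :: "(nat \<Rightarrow> real) \<Rightarrow> real" and R x
  have [measurable]: "f \<in> borel_measurable (leb n)" "g \<in> borel_measurable (leb n)" "h \<in> borel_measurable (leb n)"
    using int by auto
  have ge: "(\<integral>x. cut f R x \<partial>leb n) powr l * (\<integral>x. cut g R x \<partial>leb n) powr (1 - l) \<le> (\<integral>x. cut h R x \<partial>leb n)" for R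
  proof (rule prekopa_leindler_box[where R = "real R" and B = B and l = l and h = "cut h R"])
    fix x y assume xy: "x \<in> Rn n" "y \<in> Rn n"
    have conv: "cmb n l x y \<in> cube n (\<lambda>_. 0) (real R)" if "x \<in> cube n (\<lambda>_. 0) (real R)" "y \<in> cube n (\<lambda>_. 0) (real R)"
    proof -
      have "\<bar>l * x i + (1 - l) * y i\<bar> \<le> real R" if "i < n" for i
      proof -
        have "\<bar>l * x i + (1 - l) * y i\<bar> \<le> l * \<bar>x i\<bar> + (1 - l) * \<bar>y i\<bar>"
          using l abs_triangle_ineq[of "l * x i" "(1 - l) * y i"] by (simp add: abs_mult)
        also have "\<dots> \<le> l * R + (1 - l) * R"
          using l \<open>i < n\<close> \<open>x \<in> cube _ _ _\<close> \<open>y \<in> cube _ _ _\<close> by (intro add_mono mult_left_mono) (auto simp: cube_iff)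
        finally show ?thesis by (simp add: algebra_simps)
      qed
      then show ?thesis by (simp add: cube_iff)
    qed
    show "cut f R x powr l * cut g R y powr (1 - l) \<le> cut h R (cmb n l x y)"
      using h[OF xy] conv bnd(3)[of "cmb n l x y"] by (auto simp: cut_def indicator_def)
  next
    fix x :: "nat \<Rightarrow> real" assume "x \<in> Rn n"
    then show "0 \<le> cut f R x \<and> cut f R x \<le> B" "0 \<le> cut g R x \<and> cut g R x \<le> B" "0 \<le> cut h R x \<and> cut h R x \<le> B"
      using bnd[of x] by (auto simp: cut_def indicator_def)
  next
    show "cut f R \<in> borel_measurable (leb n)" "cut g R \<in> borel_measurable (leb n)" "cut h R \<in> borel_measurable (leb n)"
      unfolding cut_def by measurable
  qed (use l in \<open>auto simp: cut_def\<close>)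
  have lim: "(\<lambda>R. \<integral>x. cut k R x \<partial>leb n) \<longlonglongrightarrow> (\<integral>x. k x \<partial>leb n)" if "integrable (leb n) k" for k
  proof (rule integral_dominated_convergence[where w = "\<lambda>x. norm (k x)"])
    show "AE x in leb n. (\<lambda>R. cut k R x) \<longlonglongrightarrow> k x"
    proof (rule AE_I2)
      fix x :: "nat \<Rightarrow> real" assume x: "x \<in> space (leb n)"
      obtain R0 :: nat where R0: "(\<Sum>i<n. \<bar>x i\<bar>) \<le> real R0" using real_arch_simple by blast
      have "x \<in> cube n (\<lambda>_. 0) (real R)" if "R0 \<le> R" for R
        using x R0 that member_le_sum[of _ "{..<n}" "\<lambda>i. \<bar>x i\<bar>"]
        by (fastforce simp: cube_iff space_leb)
      then have "\<forall>\<^sub>F R in sequentially. cut k R x = k x"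
        by (auto simp: eventually_sequentially cut_def intro!: exI[of _ R0])
      then show "(\<lambda>R. cut k R x) \<longlonglongrightarrow> k x" by (rule tendsto_eventually)
    qed
    show "AE x in leb n. norm (cut k R x) \<le> norm (k x)" for R
      by (auto simp: cut_def indicator_def)
    show "cut k R \<in> borel_measurable (leb n)" for R
      using that unfolding cut_def by measurable
  qed (use that in auto)
  show ?thesis
  proof (rule LIMSEQ_le[OF _ lim[OF int(3)]])
    show "(\<lambda>R. (\<integral>x. cut f R x \<partial>leb n) powr l * (\<integral>x. cut g R x \<partial>leb n) powr (1 - l))
      \<longlonglongrightarrow> (\<integral>x. f x \<partial>leb n) powr l * (\<integral>x. g x \<partial>leb n) powr (1 - l)"
      using l bnd(1,2) by (intro tendsto_mult tendsto_powr2 lim int tendsto_const)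
        (auto intro!: always_eventually Bochner_Integration.integral_nonneg_AE AE_I2 simp: space_leb cut_def)
  qed (use ge in auto)
qed

section \<open>Convolution\<close>

definition addv :: "nat \<Rightarrow> (nat \<Rightarrow> real) \<Rightarrow> (nat \<Rightarrow> real) \<Rightarrow> (nat \<Rightarrow> real)" where
  "addv n x y = restrict (\<lambda>i. x i + y i) {..<n}"

definition subv :: "nat \<Rightarrow> (nat \<Rightarrow> real) \<Rightarrow> (nat \<Rightarrow> real) \<Rightarrow> (nat \<Rightarrow> real)" where
  "subv n x y = restrict (\<lambda>i. x i - y i) {..<n}"

definition affv :: "nat \<Rightarrow> (nat \<Rightarrow> real) \<Rightarrow> real \<Rightarrow> (nat \<Rightarrow> real) \<Rightarrow> (nat \<Rightarrow> real)" where
  "affv n b c x = restrict (\<lambda>i. b i + c * x i) {..<n}"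

lemma vec_in_Rn [simp]: "addv n x y \<in> Rn n" "subv n x y \<in> Rn n" "affv n b c x \<in> Rn n"
  by (auto simp: addv_def subv_def affv_def)

lemma vec_nth [simp]:
  "i < n \<Longrightarrow> addv n x y i = x i + y i" "i < n \<Longrightarrow> subv n x y i = x i - y i" "i < n \<Longrightarrow> affv n b c x i = b i + c * x i"
  by (auto simp: addv_def subv_def affv_def)

lemma Rn_eqI: "x \<in> Rn n \<Longrightarrow> y \<in> Rn n \<Longrightarrow> (\<And>i. i < n \<Longrightarrow> x i = y i) \<Longrightarrow> x = y"
  by (rule PiE_ext) auto

lemma measurable_affv [measurable]: "affv n b c \<in> leb n \<rightarrow>\<^sub>M leb n"
  unfolding affv_def by measurable

lemma measurable_addv [measurable]: "(\<lambda>(x, y). addv n x y) \<in> leb n \<Otimes>\<^sub>M leb n \<rightarrow>\<^sub>M leb n"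
  unfolding addv_def by measurable

lemma measurable_subv [measurable]: "(\<lambda>(x, y). subv n x y) \<in> leb n \<Otimes>\<^sub>M leb n \<rightarrow>\<^sub>M leb n"
  unfolding subv_def by measurable

lemma measurable_ip [measurable]: "ip n c \<in> borel_measurable (leb n)"
  unfolding ip_def by measurable

lemma ip_addv: "ip n c (addv n x y) = ip n c x + ip n c y"
  by (simp add: ip_def algebra_simps sum.distrib)

text \<open>Serves as translation (\<open>c = 1\<close>), reflection (\<open>c = -1\<close>),
  halving in the midpoint argument, and rescaling by the number of copies.\<close>

lemma nn_integral_leb_affine:
  assumes "f \<in> borel_measurable (leb n)" "c \<noteq> 0"
  shows "(\<integral>\<^sup>+x. f x \<partial>leb n) = ennreal (\<bar>c\<bar> ^ n) * (\<integral>\<^sup>+x. f (affv n b c x) \<partial>leb n)"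
  using assms(1)
proof (induction n arbitrary: f)
  case 0
  have "affv 0 b c x = (\<lambda>_. undefined)" for x by (simp add: affv_def fun_eq_iff)
  then show ?case by (simp add: PiM_empty nn_integral_count_space_finite)
next
  case (Suc n)
  note [measurable] = Suc.prems
  have upd: "affv (Suc n) b c (x(n := s)) = (affv n b c x)(n := b n + c * s)" for x s
    by (auto simp: affv_def fun_eq_iff less_Suc_eq)
  have m: "(\<lambda>x. \<integral>\<^sup>+s. f (x(n := s)) \<partial>lborel) \<in> borel_measurable (leb n)"
    using measurable_leb_upd[OF Suc.prems] by (rule lborel.borel_measurable_nn_integral)
  have "(\<integral>\<^sup>+x. f x \<partial>leb (Suc n)) = (\<integral>\<^sup>+x. (\<integral>\<^sup>+s. f (x(n := s)) \<partial>lborel) \<partial>leb n)"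
    unfolding leb_Suc using Suc.prems by (intro lebs.product_nn_integral_insert) (auto simp: leb_Suc)
  also have "\<dots> = ennreal (\<bar>c\<bar> ^ n) * (\<integral>\<^sup>+x. (\<integral>\<^sup>+s. f ((affv n b c x)(n := s)) \<partial>lborel) \<partial>leb n)"
    using m by (rule Suc.IH)
  also have "(\<integral>\<^sup>+x. (\<integral>\<^sup>+s. f ((affv n b c x)(n := s)) \<partial>lborel) \<partial>leb n)
     = (\<integral>\<^sup>+x. ennreal \<bar>c\<bar> * (\<integral>\<^sup>+s. f (affv (Suc n) b c (x(n := s))) \<partial>lborel) \<partial>leb n)"
    unfolding upd
    using measurable_leb_upd_section[OF Suc.prems, of "affv n b c _"] assms(2)
    by (intro nn_integral_cong nn_integral_real_affine) auto
  also have "\<dots> = ennreal \<bar>c\<bar> * (\<integral>\<^sup>+x. (\<integral>\<^sup>+s. f (affv (Suc n) b c (x(n := s))) \<partial>lborel) \<partial>leb n)"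
    by (intro nn_integral_cmult lborel.borel_measurable_nn_integral
        measurable_leb_upd[of "\<lambda>x. f (affv (Suc n) b c x)"]) measurable
  also have "(\<integral>\<^sup>+x. (\<integral>\<^sup>+s. f (affv (Suc n) b c (x(n := s))) \<partial>lborel) \<partial>leb n)
      = (\<integral>\<^sup>+x. f (affv (Suc n) b c x) \<partial>leb (Suc n))"
  proof -
    have "(\<lambda>x. f (affv (Suc n) b c x)) \<in> borel_measurable (leb (Suc n))" by measurable
    then show ?thesis unfolding leb_Suc
      by (intro lebs.product_nn_integral_insert[symmetric]) (auto simp: leb_Suc)
  qed
  finally show ?case by (simp add: ennreal_mult' mult_ac)
qed

definition conv :: "nat \<Rightarrow> (nat \<Rightarrow> real) measure \<Rightarrow> (nat \<Rightarrow> real) measure \<Rightarrow> (nat \<Rightarrow> real) measure" where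
  "conv n P Q = distr (P \<Otimes>\<^sub>M Q) (leb n) (\<lambda>(x, y). addv n x y)"

locale prob_Rn = prob_space P for n :: nat and P :: "(nat \<Rightarrow> real) measure" +
  assumes sets_P [measurable_cong, simp]: "sets P = sets (leb n)"
begin

lemma space_P [simp]: "space P = Rn n"
  using sets_eq_imp_space_eq[OF sets_P] by (simp add: space_leb)

lemma prob_Rn_eq_1 [simp]: "prob (Rn n) = 1"
  using prob_space by simp

end

locale prob_Rn_pair = X: prob_Rn n P + Y: prob_Rn n Q for n P Q
begin

sublocale PQ: pair_prob_space P Q ..

lemma measurable_addv_pair [measurable]: "(\<lambda>(x, y). addv n x y) \<in> P \<Otimes>\<^sub>M Q \<rightarrow>\<^sub>M leb n"
  by measurable

sublocale C: prob_Rn n "conv n P Q"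
  unfolding conv_def by (intro prob_Rn.intro PQ.P.prob_space_distr prob_Rn_axioms.intro) auto

lemma nn_integral_conv:
  assumes [measurable]: "h \<in> borel_measurable (leb n)"
  shows "(\<integral>\<^sup>+z. h z \<partial>conv n P Q) = (\<integral>\<^sup>+x. \<integral>\<^sup>+y. h (addv n x y) \<partial>Q \<partial>P)"
proof -
  have "(\<integral>\<^sup>+z. h z \<partial>conv n P Q) = (\<integral>\<^sup>+z. h (addv n (fst z) (snd z)) \<partial>(P \<Otimes>\<^sub>M Q))"
    unfolding conv_def by (subst nn_integral_distr) (auto simp: case_prod_beta')
  also have "\<dots> = (\<integral>\<^sup>+x. \<integral>\<^sup>+y. h (addv n (fst (x, y)) (snd (x, y))) \<partial>Q \<partial>P)"
    by (subst Y.nn_integral_fst) (auto simp: case_prod_beta')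
  finally show ?thesis by simp
qed

text \<open>By independence the left side is the mass of a rectangle, and addition maps this
  rectangle into the half-space on the right. Each doubling therefore squares the available
  half-space bound.\<close>

lemma halfspace_conv:
  "measure P {x \<in> Rn n. s \<le> ip n c x} * measure Q {x \<in> Rn n. t \<le> ip n c x}
     \<le> measure (conv n P Q) {x \<in> Rn n. s + t \<le> ip n c x}"
proof -
  let ?A = "{x \<in> Rn n. s \<le> ip n c x}" and ?B = "{x \<in> Rn n. t \<le> ip n c x}"
    and ?C = "{x \<in> Rn n. s + t \<le> ip n c x}"
  have m: "{x \<in> Rn n. u \<le> ip n c x} \<in> sets (leb n)" for u
    unfolding space_leb[symmetric] by measurable
  have "measure P ?A * measure Q ?B = measure (P \<Otimes>\<^sub>M Q) (?A \<times> ?B)"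
    using m by (simp add: measure_def Y.emeasure_pair_measure_Times enn2real_mult)
  also have "\<dots> \<le> measure (P \<Otimes>\<^sub>M Q) ((\<lambda>(x, y). addv n x y) -` ?C \<inter> space (P \<Otimes>\<^sub>M Q))"
  proof (rule PQ.P.finite_measure_mono[OF _ measurable_sets[OF measurable_addv_pair m]], rule subsetI)
    fix z assume "z \<in> ?A \<times> ?B"
    then obtain x y where "z = (x, y)" "x \<in> Rn n" "y \<in> Rn n" "s \<le> ip n c x" "t \<le> ip n c y" by blast
    then show "z \<in> (\<lambda>(x, y). addv n x y) -` ?C \<inter> space (P \<Otimes>\<^sub>M Q)"
      by (simp add: ip_addv space_pair_measure add_mono)
  qed
  also have "\<dots> = measure (conv n P Q) ?C"
    unfolding conv_def by (rule measure_distr[OF measurable_addv_pair m, symmetric])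
  finally show ?thesis .
qed

lemma integral_pair_mult:
  fixes f g :: "(nat \<Rightarrow> real) \<Rightarrow> real"
  assumes f: "integrable P f" and g: "integrable Q g"
  shows "integrable (P \<Otimes>\<^sub>M Q) (\<lambda>(x, y). f x * g y)"
    and "(\<integral>(x, y). f x * g y \<partial>(P \<Otimes>\<^sub>M Q)) = (\<integral>x. f x \<partial>P) * (\<integral>y. g y \<partial>Q)"
proof -
  have [measurable]: "f \<in> borel_measurable P" "g \<in> borel_measurable Q" using f g by auto
  show int: "integrable (P \<Otimes>\<^sub>M Q) (\<lambda>(x, y). f x * g y)"
    using f g by (intro PQ.Fubini_integrable) (auto simp: abs_mult)
  show "(\<integral>(x, y). f x * g y \<partial>(P \<Otimes>\<^sub>M Q)) = (\<integral>x. f x \<partial>P) * (\<integral>y. g y \<partial>Q)"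
    by (subst PQ.integral_fst'[symmetric, OF int]) simp
qed

text \<open>Centering kills the cross term. Second moments thus double with each self-convolution,
  while thresholds of half-spaces double as lengths; this discrepancy is the whole gain from taking
  sums.\<close>

lemma moments_conv:
  assumes P: "integrable P (\<lambda>x. (ip n c x)\<^sup>2)" "(\<integral>x. ip n c x \<partial>P) = 0"
    and Q: "integrable Q (\<lambda>x. (ip n c x)\<^sup>2)" "(\<integral>x. ip n c x \<partial>Q) = 0"
  shows "integrable (conv n P Q) (\<lambda>x. (ip n c x)\<^sup>2)" "(\<integral>x. ip n c x \<partial>conv n P Q) = 0"
    "(\<integral>x. (ip n c x)\<^sup>2 \<partial>conv n P Q) = (\<integral>x. (ip n c x)\<^sup>2 \<partial>P) + (\<integral>x. (ip n c x)\<^sup>2 \<partial>Q)"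
proof -
  have P1: "integrable P (\<lambda>x. ip n c x)" by (rule X.square_integrable_imp_integrable[OF _ P(1)]) measurable
  have Q1: "integrable Q (\<lambda>x. ip n c x)" by (rule Y.square_integrable_imp_integrable[OF _ Q(1)]) measurable
  have one: "integrable P (\<lambda>_. 1 :: real)" "integrable Q (\<lambda>_. 1 :: real)" by auto
  note a = integral_pair_mult[OF P1 one(2)] and b = integral_pair_mult[OF one(1) Q1]
  note a2 = integral_pair_mult[OF P(1) one(2)] and ab = integral_pair_mult[OF P1 Q1] and b2 = integral_pair_mult[OF one(1) Q(1)]
  have sq: "(\<lambda>z. (ip n c (case z of (x, y) \<Rightarrow> addv n x y))\<^sup>2)
     = (\<lambda>z. (case z of (x, y) \<Rightarrow> (ip n c x)\<^sup>2 * 1) + 2 * (case z of (x, y) \<Rightarrow> ip n c x * ip n c y) + (case z of (x, y) \<Rightarrow> 1 * (ip n c y)\<^sup>2))"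
    by (auto simp: fun_eq_iff ip_addv power2_eq_square algebra_simps)
  have lin: "(\<lambda>z. ip n c (case z of (x, y) \<Rightarrow> addv n x y))
     = (\<lambda>z. (case z of (x, y) \<Rightarrow> ip n c x * 1) + (case z of (x, y) \<Rightarrow> 1 * ip n c y))"
    by (auto simp: fun_eq_iff ip_addv)
  have int2: "integrable (P \<Otimes>\<^sub>M Q) (\<lambda>z. (ip n c (case z of (x, y) \<Rightarrow> addv n x y))\<^sup>2)"
    unfolding sq by (intro Bochner_Integration.integrable_add integrable_mult_right a2 ab b2)
  have m1: "(\<lambda>x. (ip n c x)\<^sup>2) \<in> borel_measurable (leb n)" by measurable
  show "integrable (conv n P Q) (\<lambda>x. (ip n c x)\<^sup>2)"
    unfolding conv_def using int2 by (subst integrable_distr_eq[OF measurable_addv_pair m1])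
  have "(\<integral>x. (ip n c x)\<^sup>2 \<partial>conv n P Q)
      = (\<integral>z. (ip n c (case z of (x, y) \<Rightarrow> addv n x y))\<^sup>2 \<partial>(P \<Otimes>\<^sub>M Q))"
    unfolding conv_def by (rule integral_distr[OF measurable_addv_pair m1])
  also have "\<dots> = (\<integral>(x, y). (ip n c x)\<^sup>2 * 1 \<partial>(P \<Otimes>\<^sub>M Q)) + 2 * (\<integral>(x, y). ip n c x * ip n c y \<partial>(P \<Otimes>\<^sub>M Q))
      + (\<integral>(x, y). 1 * (ip n c y)\<^sup>2 \<partial>(P \<Otimes>\<^sub>M Q))"
    unfolding sq
    by (subst Bochner_Integration.integral_add, intro Bochner_Integration.integrable_add integrable_mult_right a2 ab, rule b2(1),
        subst Bochner_Integration.integral_add, rule a2(1), intro integrable_mult_right ab(1), subst integral_mult_right_zero, rule refl)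
  finally show "(\<integral>x. (ip n c x)\<^sup>2 \<partial>conv n P Q) = (\<integral>x. (ip n c x)\<^sup>2 \<partial>P) + (\<integral>x. (ip n c x)\<^sup>2 \<partial>Q)"
    unfolding a2(2) ab(2) b2(2) P(2) by simp
  have "(\<integral>x. ip n c x \<partial>conv n P Q) = (\<integral>z. ip n c (case z of (x, y) \<Rightarrow> addv n x y) \<partial>(P \<Otimes>\<^sub>M Q))"
    unfolding conv_def by (rule integral_distr[OF measurable_addv_pair measurable_ip])
  also have "\<dots> = (\<integral>(x, y). ip n c x * 1 \<partial>(P \<Otimes>\<^sub>M Q)) + (\<integral>(x, y). 1 * ip n c y \<partial>(P \<Otimes>\<^sub>M Q))"
    unfolding lin by (rule Bochner_Integration.integral_add[OF a(1) b(1)])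
  finally show "(\<integral>x. ip n c x \<partial>conv n P Q) = 0"
    unfolding a(2) b(2) P(2) Q(2) by simp
qed

text \<open>Translation invariance and Tonelli. Only \<open>Q\<close> carries a density here, so the
  same statement covers both smoothing an arbitrary \<open>P\<close> by a uniform law and
  self-convolution.\<close>

lemma conv_density:
  fixes q :: "(nat \<Rightarrow> real) \<Rightarrow> real"
  assumes q [measurable]: "q \<in> borel_measurable (leb n)" and bnd: "\<And>x. x \<in> Rn n \<Longrightarrow> 0 \<le> q x \<and> q x \<le> B"
    and Q: "Q = density (leb n) (\<lambda>x. ennreal (q x))"
  shows "conv n P Q = density (leb n) (\<lambda>z. ennreal (\<integral>y. q (subv n z y) \<partial>P))"
proof (rule measure_eqI)
  interpret L: sigma_finite_measure "leb n" by (rule lebs.sigma_finite) simp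
  interpret LP: pair_sigma_finite "leb n" P ..
  show "sets (conv n P Q) = sets (density (leb n) (\<lambda>z. ennreal (\<integral>y. q (subv n z y) \<partial>P)))" by simp
  fix A assume "A \<in> sets (conv n P Q)"
  then have [measurable]: "A \<in> sets (leb n)" by simp
  have nn: "ennreal (\<integral>y. q (subv n z y) \<partial>P) = (\<integral>\<^sup>+y. ennreal (q (subv n z y)) \<partial>P)" if "z \<in> Rn n" for z
  proof (rule nn_integral_eq_integral[symmetric])
    have "z \<in> space (leb n)" using that by (simp add: space_leb)
    then have "(\<lambda>y. q (subv n z y)) \<in> borel_measurable P" by measurable
    then show "integrable P (\<lambda>y. q (subv n z y))"
      using bnd by (intro X.integrable_const_bound[where B = B]) auto
  qed (use bnd in auto)
  have mG: "(\<lambda>z. \<integral>y. q (subv n z y) \<partial>P) \<in> borel_measurable (leb n)"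
    by (rule X.borel_measurable_lebesgue_integral) measurable
  have "emeasure (conv n P Q) A = (\<integral>\<^sup>+z. indicator A z \<partial>conv n P Q)" by simp
  also have "\<dots> = (\<integral>\<^sup>+x. \<integral>\<^sup>+y. indicator A (addv n x y) \<partial>Q \<partial>P)"
    by (rule nn_integral_conv) measurable
  also have "\<dots> = (\<integral>\<^sup>+x. \<integral>\<^sup>+z. ennreal (q (subv n z x)) * indicator A z \<partial>leb n \<partial>P)"
  proof (intro nn_integral_cong)
    fix x assume "x \<in> space P"
    then have x: "x \<in> space (leb n)" by (simp add: space_leb)
    have "(\<integral>\<^sup>+y. indicator A (addv n x y) \<partial>Q) = (\<integral>\<^sup>+y. ennreal (q y) * indicator A (addv n x y) \<partial>leb n)"
      unfolding Q using x by (subst nn_integral_density) auto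
    also have "\<dots> = (\<integral>\<^sup>+y. ennreal (q (subv n (affv n x 1 y) x)) * indicator A (affv n x 1 y) \<partial>leb n)"
    proof (intro nn_integral_cong)
      fix y :: "nat \<Rightarrow> real" assume "y \<in> space (leb n)"
      then have "y \<in> Rn n" by (simp add: space_leb)
      then have "subv n (affv n x 1 y) x = y" by (rule Rn_eqI[OF vec_in_Rn(2)]) simp
      moreover have "addv n x y = affv n x 1 y" by (simp add: addv_def affv_def)
      ultimately show "ennreal (q y) * indicator A (addv n x y) = ennreal (q (subv n (affv n x 1 y) x)) * indicator A (affv n x 1 y)"
        by simp
    qed
    also have "\<dots> = (\<integral>\<^sup>+z. ennreal (q (subv n z x)) * indicator A z \<partial>leb n)"
      using x by (subst nn_integral_leb_affine[of _ n 1 x]) auto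
    finally show "(\<integral>\<^sup>+y. indicator A (addv n x y) \<partial>Q) = (\<integral>\<^sup>+z. ennreal (q (subv n z x)) * indicator A z \<partial>leb n)" .
  qed
  also have "\<dots> = (\<integral>\<^sup>+z. \<integral>\<^sup>+x. ennreal (q (subv n z x)) * indicator A z \<partial>P \<partial>leb n)"
    by (rule LP.Fubini') measurable
  also have "\<dots> = (\<integral>\<^sup>+z. ennreal (\<integral>y. q (subv n z y) \<partial>P) * indicator A z \<partial>leb n)"
    by (intro nn_integral_cong) (simp add: nn space_leb nn_integral_multc)
  also have "\<dots> = emeasure (density (leb n) (\<lambda>z. ennreal (\<integral>y. q (subv n z y) \<partial>P))) A"
    by (rule emeasure_density[symmetric]) (use mG in measurable)
  finally show "emeasure (conv n P Q) A = emeasure (density (leb n) (\<lambda>z. ennreal (\<integral>y. q (subv n z y) \<partial>P))) A" .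
qed

end

section \<open>Log-concave densities and smoothing\<close>

definition log_concave_fun :: "nat \<Rightarrow> ((nat \<Rightarrow> real) \<Rightarrow> real) \<Rightarrow> bool" where
  "log_concave_fun n g \<longleftrightarrow> (\<forall>x\<in>Rn n. \<forall>y\<in>Rn n. \<forall>l. 0 < l \<and> l < 1 \<longrightarrow>
     g x powr l * g y powr (1 - l) \<le> g (cmb n l x y))"

text \<open>Stated with coordinatewise convergent sequences, since dominated convergence produces
  continuity in this form and closedness of level sets consumes it.\<close>

definition seq_cont :: "nat \<Rightarrow> ((nat \<Rightarrow> real) \<Rightarrow> real) \<Rightarrow> bool" where
  "seq_cont n g \<longleftrightarrow> (\<forall>X x. (\<forall>k. X k \<in> Rn n) \<and> x \<in> Rn n \<and> (\<forall>i<n. (\<lambda>k. X k i) \<longlonglongrightarrow> x i)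
     \<longrightarrow> (\<lambda>k. g (X k)) \<longlonglongrightarrow> g x)"

text \<open>\<open>g\<close> is one fixed version of the density whose properties hold at every
  point, as the separation of points from level sets requires.\<close>

locale lc_prob = prob_Rn n P for n P +
  fixes g :: "(nat \<Rightarrow> real) \<Rightarrow> real" and B :: real
  assumes g_meas [measurable]: "g \<in> borel_measurable (leb n)"
    and g_nonneg: "\<And>x. x \<in> Rn n \<Longrightarrow> 0 \<le> g x"
    and g_le: "\<And>x. x \<in> Rn n \<Longrightarrow> g x \<le> B"
    and g_lc: "log_concave_fun n g"
    and g_cont: "seq_cont n g"
    and P_density: "P = density (leb n) (\<lambda>x. ennreal (g x))"
begin

lemma AE_g_nonneg: "AE x in leb n. 0 \<le> g x"
  by (rule AE_I2) (simp add: space_leb g_nonneg)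

lemma integrable_density_P:
  fixes f :: "(nat \<Rightarrow> real) \<Rightarrow> real"
  assumes "f \<in> borel_measurable (leb n)"
  shows "integrable P f \<longleftrightarrow> integrable (leb n) (\<lambda>x. g x * f x)"
  using integrable_density[OF assms g_meas AE_g_nonneg] by (simp add: P_density)

lemma integral_density_P:
  fixes f :: "(nat \<Rightarrow> real) \<Rightarrow> real"
  assumes "f \<in> borel_measurable (leb n)"
  shows "(\<integral>x. f x \<partial>P) = (\<integral>x. g x * f x \<partial>leb n)"
  using integral_density[OF assms g_meas AE_g_nonneg] by (simp add: P_density)

text \<open>For the convolved density, log-concavity is Prekopa-Leindler in \<open>y\<close> for the
  products \<open>g y * g (subv n z y)\<close>, which are log-concave jointly in \<open>z\<close>
  and \<open>y\<close>. The bound \<open>B\<close> survives because the new density is an average of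
  values of \<open>g\<close>.\<close>

lemma lc_prob_conv_self: "lc_prob n (conv n P P) (\<lambda>z. \<integral>y. g (subv n z y) \<partial>P) B"
proof -
  interpret PP: prob_Rn_pair n P P ..
  let ?G = "\<lambda>z. \<integral>y. g (subv n z y) \<partial>P"
  have sec [measurable]: "(\<lambda>y. g (subv n z y)) \<in> borel_measurable (leb n)" if "z \<in> Rn n" for z
  proof -
    have "z \<in> space (leb n)" using that by (simp add: space_leb)
    then show ?thesis by measurable
  qed
  have int: "integrable P (\<lambda>y. g (subv n z y))" if "z \<in> Rn n" for z
    using sec[OF that] g_nonneg g_le by (intro integrable_const_bound[where B = B]) auto
  show ?thesis
  proof (unfold_locales)
    show "?G \<in> borel_measurable (leb n)" by measurable
    show "0 \<le> ?G z" for z using g_nonneg by simp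
    show "?G z \<le> B" if "z \<in> Rn n" for z
    proof -
      have "?G z \<le> (\<integral>y. B \<partial>P)" using g_le by (intro integral_mono int that) auto
      then show ?thesis by (simp add: prob_space)
    qed
    show "conv n P P = density (leb n) (\<lambda>z. ennreal (?G z))"
      using g_nonneg g_le P_density by (intro PP.conv_density[where B = B]) auto
    show "seq_cont n ?G"
      unfolding seq_cont_def
    proof (intro allI impI, elim conjE)
      fix X x assume X: "\<forall>k. X k \<in> Rn n" and x: "x \<in> Rn n" and lim: "\<forall>i<n. (\<lambda>k. X k i) \<longlonglongrightarrow> x i"
      show "(\<lambda>k. ?G (X k)) \<longlonglongrightarrow> ?G x"
      proof (rule integral_dominated_convergence[where w = "\<lambda>_. B"])
        show "AE y in P. (\<lambda>k. g (subv n (X k) y)) \<longlonglongrightarrow> g (subv n x y)"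
        proof (rule AE_I2)
          fix y
          have "\<forall>i<n. (\<lambda>k. subv n (X k) y i) \<longlonglongrightarrow> subv n x y i"
            using lim by (auto intro!: tendsto_diff)
          then show "(\<lambda>k. g (subv n (X k) y)) \<longlonglongrightarrow> g (subv n x y)"
            using g_cont unfolding seq_cont_def by simp
        qed
      qed (use sec X x g_nonneg g_le in auto)
    qed
    show "log_concave_fun n ?G"
      unfolding log_concave_fun_def
    proof (intro ballI allI impI, elim conjE)
      fix z w l assume z: "z \<in> Rn n" and w: "w \<in> Rn n" and l: "0 < l" "l < (1::real)"
      have bnd: "0 \<le> g y * g (subv n u y) \<and> g y * g (subv n u y) \<le> B * B" if "y \<in> Rn n" for y u
        by (intro conjI mult_mono mult_nonneg_nonneg g_nonneg g_le that vec_in_Rn order_trans[OF g_nonneg[OF that] g_le[OF that]])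
      have "(\<integral>y. g y * g (subv n z y) \<partial>leb n) powr l * (\<integral>y. g y * g (subv n w y) \<partial>leb n) powr (1 - l)
          \<le> (\<integral>y. g y * g (subv n (cmb n l z w) y) \<partial>leb n)"
      proof (rule prekopa_leindler[where B = "B * B"])
        fix x y assume xy: "x \<in> Rn n" "y \<in> Rn n"
        have 1: "g x powr l * g y powr (1 - l) \<le> g (cmb n l x y)"
          using g_lc xy l by (simp add: log_concave_fun_def)
        have eq: "cmb n l (subv n z x) (subv n w y) = subv n (cmb n l z w) (cmb n l x y)"
          by (rule Rn_eqI[OF cmb_in_Rn vec_in_Rn(2)]) (simp add: algebra_simps)
        have 2: "g (subv n z x) powr l * g (subv n w y) powr (1 - l) \<le> g (subv n (cmb n l z w) (cmb n l x y))"
          using g_lc l unfolding log_concave_fun_def eq[symmetric] by simp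
        have "(g x * g (subv n z x)) powr l * (g y * g (subv n w y)) powr (1 - l)
           = (g x powr l * g y powr (1 - l)) * (g (subv n z x) powr l * g (subv n w y) powr (1 - l))"
          using xy g_nonneg by (simp add: powr_mult)
        also have "\<dots> \<le> g (cmb n l x y) * g (subv n (cmb n l z w) (cmb n l x y))"
          using 1 2 g_nonneg by (intro mult_mono) auto
        finally show "(g x * g (subv n z x)) powr l * (g y * g (subv n w y)) powr (1 - l)
           \<le> g (cmb n l x y) * g (subv n (cmb n l z w) (cmb n l x y))" .
      qed (simp_all only: l bnd int[OF z] int[OF w] int[OF cmb_in_Rn] integrable_density_P[OF sec, OF z, symmetric]
          integrable_density_P[OF sec, OF w, symmetric] integrable_density_P[OF sec, OF cmb_in_Rn, symmetric])
      then show "?G z powr l * ?G w powr (1 - l) \<le> ?G (cmb n l z w)"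
        by (simp only: integral_density_P[OF sec, OF z] integral_density_P[OF sec, OF w] integral_density_P[OF sec, OF cmb_in_Rn])
    qed
  qed
qed

end

section \<open>The uniform law on a small cube\<close>

definition unif :: "nat \<Rightarrow> real \<Rightarrow> (nat \<Rightarrow> real) measure" where
  "unif n r = density (leb n) (\<lambda>x. ennreal (indicator (cube n (\<lambda>_. 0) r) x / (2 * r) ^ n))"

context
  fixes n :: nat and r :: real
  assumes r: "0 < r"
begin

lemma prob_Rn_unif: "prob_Rn n (unif n r)"
proof (intro prob_Rn.intro prob_spaceI prob_Rn_axioms.intro)
  have "emeasure (unif n r) (space (unif n r)) = (\<integral>\<^sup>+x. ennreal (1 / (2 * r) ^ n) * indicator (cube n (\<lambda>_. 0) r) x \<partial>leb n)"
    unfolding unif_def by (subst emeasure_density) (auto intro!: nn_integral_cong simp: indicator_def)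
  also have "\<dots> = 1"
    using r by (subst nn_integral_cmult_indicator) (auto simp: emeasure_cube simp flip: ennreal_mult')
  finally show "emeasure (unif n r) (space (unif n r)) = 1" .
qed (simp add: unif_def)

interpretation U: prob_Rn n "unif n r" by (rule prob_Rn_unif)

lemma AE_unif: "AE x in unif n r. x \<in> cube n (\<lambda>_. 0) r"
  unfolding unif_def using r by (subst AE_density) (auto intro!: AE_I2 simp: indicator_def)

lemma unif_reflect: "distr (unif n r) (leb n) (affv n (\<lambda>_. 0) (-1)) = unif n r"
proof (rule measure_eqI)
  fix A assume "A \<in> sets (distr (unif n r) (leb n) (affv n (\<lambda>_. 0) (-1)))"
  then have A [measurable]: "A \<in> sets (leb n)" by simp
  let ?q = "\<lambda>x. ennreal (indicator (cube n (\<lambda>_. 0) r) x / (2 * r) ^ n)"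
  have "emeasure (distr (unif n r) (leb n) (affv n (\<lambda>_. 0) (-1))) A
      = (\<integral>\<^sup>+x. indicator A x \<partial>distr (unif n r) (leb n) (affv n (\<lambda>_. 0) (-1)))" by simp
  also have "\<dots> = (\<integral>\<^sup>+x. indicator A (affv n (\<lambda>_. 0) (-1) x) \<partial>unif n r)"
    by (subst nn_integral_distr) auto
  also have "\<dots> = (\<integral>\<^sup>+x. ?q x * indicator A (affv n (\<lambda>_. 0) (-1) x) \<partial>leb n)"
    unfolding unif_def by (subst nn_integral_density) auto
  also have "\<dots> = (\<integral>\<^sup>+x. ?q (affv n (\<lambda>_. 0) (-1) x) * indicator A (affv n (\<lambda>_. 0) (-1) x) \<partial>leb n)"
    by (intro nn_integral_cong) (auto simp: space_leb indicator_def cube_iff)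
  also have "\<dots> = (\<integral>\<^sup>+x. ?q x * indicator A x \<partial>leb n)"
    by (subst nn_integral_leb_affine[of "\<lambda>x. ?q x * indicator A x" n "-1" "\<lambda>_. 0"]) auto
  also have "\<dots> = emeasure (unif n r) A"
    unfolding unif_def by (subst emeasure_density) auto
  finally show "emeasure (distr (unif n r) (leb n) (affv n (\<lambda>_. 0) (-1))) A = emeasure (unif n r) A" .
qed simp

lemma ip_reflect: "ip n c (affv n (\<lambda>_. 0) (-1) x) = - ip n c x"
  by (simp add: ip_def sum_negf)

lemma unif_moments:
  "integrable (unif n r) (\<lambda>x. (ip n c x)\<^sup>2)" "(\<integral>x. ip n c x \<partial>unif n r) = 0"
  "(\<integral>x. (ip n c x)\<^sup>2 \<partial>unif n r) \<le> (r * (\<Sum>i<n. \<bar>c i\<bar>))\<^sup>2"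
proof -
  have bnd: "(ip n c x)\<^sup>2 \<le> (r * (\<Sum>i<n. \<bar>c i\<bar>))\<^sup>2" if "x \<in> cube n (\<lambda>_. 0) r" for x
  proof -
    have "\<bar>ip n c x\<bar> \<le> (\<Sum>i<n. \<bar>c i * x i\<bar>)" unfolding ip_def by (rule sum_abs)
    also have "\<dots> \<le> (\<Sum>i<n. \<bar>c i\<bar> * r)"
      using that by (intro sum_mono) (auto simp: abs_mult cube_iff intro!: mult_left_mono)
    finally have "\<bar>ip n c x\<bar> \<le> \<bar>r * (\<Sum>i<n. \<bar>c i\<bar>)\<bar>" by (simp add: sum_distrib_left mult.commute)
    then show ?thesis by (simp only: abs_le_square_iff)
  qed
  show 1: "integrable (unif n r) (\<lambda>x. (ip n c x)\<^sup>2)"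
    using AE_unif bnd by (intro U.integrable_const_bound[where B = "(r * (\<Sum>i<n. \<bar>c i\<bar>))\<^sup>2"]) auto
  show "(\<integral>x. (ip n c x)\<^sup>2 \<partial>unif n r) \<le> (r * (\<Sum>i<n. \<bar>c i\<bar>))\<^sup>2"
  proof -
    have "(\<integral>x. (ip n c x)\<^sup>2 \<partial>unif n r) \<le> (\<integral>x. (r * (\<Sum>i<n. \<bar>c i\<bar>))\<^sup>2 \<partial>unif n r)"
      using AE_unif bnd by (intro integral_mono_AE 1) auto
    then show ?thesis by (simp add: U.prob_space)
  qed
  have "(\<integral>x. ip n c x \<partial>unif n r) = (\<integral>x. ip n c x \<partial>distr (unif n r) (leb n) (affv n (\<lambda>_. 0) (-1)))"
    by (simp add: unif_reflect)
  also have "\<dots> = - (\<integral>x. ip n c x \<partial>unif n r)"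
    by (subst integral_distr) (auto simp: ip_reflect)
  finally show "(\<integral>x. ip n c x \<partial>unif n r) = 0" by simp
qed

text \<open>Reflection exchanges two half-spaces that cover the space. The value 1/2 is the price of
  smoothing and becomes the factor 2 in the depth estimate.\<close>

lemma unif_halfspace: "1 / 2 \<le> measure (unif n r) {x \<in> Rn n. 0 \<le> ip n c x}"
proof -
  let ?A = "{x \<in> Rn n. 0 \<le> ip n c x}" and ?A' = "{x \<in> Rn n. ip n c x \<le> 0}"
  have mA [measurable]: "?A \<in> sets (leb n)" "?A' \<in> sets (leb n)"
    unfolding space_leb[symmetric] by measurable
  have "measure (unif n r) ?A = measure (distr (unif n r) (leb n) (affv n (\<lambda>_. 0) (-1))) ?A"
    by (simp add: unif_reflect)
  also have "\<dots> = measure (unif n r) ?A'"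
    by (subst measure_distr) (auto intro!: arg_cong[where f = "measure (unif n r)"] simp: ip_reflect)
  finally have eq: "measure (unif n r) ?A = measure (unif n r) ?A'" .
  have "{x \<in> S. 0 \<le> f x} \<union> {x \<in> S. f x \<le> 0} = S" for S and f :: "(nat \<Rightarrow> real) \<Rightarrow> real" by auto
  then have "?A \<union> ?A' = Rn n" .
  then have "1 = measure (unif n r) (?A \<union> ?A')" by simp
  also have "\<dots> \<le> measure (unif n r) ?A + measure (unif n r) ?A'"
    by (rule measure_Un_le) (simp_all only: U.sets_P mA)
  finally show ?thesis using eq by simp
qed

end

section \<open>Smoothing a log-concave measure by a cube\<close>

lemma compact_cube: "compact (cube n x r)"
proof -
  \<comment> \<open>The topology behind \<open>compact\<close> is the product topology over all
    natural indices, so the coordinates from \<open>n\<close> on are written as factors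
    \<open>{undefined}\<close> before Tychonoff's theorem applies.\<close>
  have eq: "cube n x r = PiE UNIV (\<lambda>i. if i < n then {x i - r..x i + r} else {undefined})"
    unfolding cube_def by (rule Set.set_eqI) (auto simp: PiE_iff extensional_def Ball_def split: if_splits)
  have "compactin (product_topology (\<lambda>_. euclidean) UNIV) (cube n x r)"
    unfolding eq compactin_PiE by auto
  then show ?thesis by (simp add: euclidean_product_topology)
qed

lemma cube_subset_Rn: "cube n x r \<subseteq> Rn n"
  by (rule subsetI) (simp only: cube_iff)

lemma mink_cube:
  assumes "0 < l" "l < 1"
  shows "mink n l (cube n x r) (cube n y r) \<subseteq> cube n (cmb n l x y) r"
proof
  fix z assume "z \<in> mink n l (cube n x r) (cube n y r)"
  then obtain a b where z: "z = cmb n l a b" and ab: "a \<in> cube n x r" "b \<in> cube n y r"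
    by (auto simp: mink_def cmb_def)
  have "\<bar>z i - cmb n l x y i\<bar> \<le> r" if "i < n" for i
  proof -
    have "\<bar>z i - cmb n l x y i\<bar> = \<bar>l * (a i - x i) + (1 - l) * (b i - y i)\<bar>"
      using that by (simp add: z algebra_simps)
    also have "\<dots> \<le> l * \<bar>a i - x i\<bar> + (1 - l) * \<bar>b i - y i\<bar>"
      using assms abs_triangle_ineq[of "l * (a i - x i)" "(1 - l) * (b i - y i)"] by (simp add: abs_mult)
    also have "\<dots> \<le> l * r + (1 - l) * r"
      using assms ab that by (intro add_mono mult_left_mono) (simp_all add: cube_iff)
    finally show ?thesis by (simp add: algebra_simps)
  qed
  then show "z \<in> cube n (cmb n l x y) r" using z by (simp add: cube_iff)
qed

lemma measurable_coord: "i < n \<Longrightarrow> (\<lambda>x. x i) \<in> borel_measurable (leb n)"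
  using measurable_component_singleton[of i "{..<n}" "\<lambda>_. lborel"] by simp

lemma coord_hyperplane_sets:
  assumes "i < n"
  shows "{x \<in> Rn n. x i = t} \<in> sets (leb n)"
proof -
  note [measurable] = measurable_coord[OF assms]
  have "{x \<in> space (leb n). x i = t} \<in> sets (leb n)" by measurable
  then show ?thesis unfolding space_leb .
qed

lemma coord_hyperplane_null:
  assumes "i < n"
  shows "emeasure (leb n) {x \<in> Rn n. x i = t} = 0"
proof -
  have "x \<in> {x \<in> Rn n. x i = t} \<longleftrightarrow> x \<in> PiE {..<n} (\<lambda>j. if j = i then {t} else UNIV)" for x
    using assms by (simp add: PiE_iff Ball_def) blast
  then have "{x \<in> Rn n. x i = t} = PiE {..<n} (\<lambda>j. if j = i then {t} else UNIV)" by (rule Set.set_eqI)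
  then have "emeasure (leb n) {x \<in> Rn n. x i = t} = (\<Prod>j<n. emeasure lborel (if j = i then {t} else UNIV))"
    by (simp add: lebs.emeasure_PiM)
  also have "\<dots> = 0" using assms by (intro prod_zero) auto
  finally show ?thesis .
qed

text \<open>Domination by \<open>M\<close> times Lebesgue measure stands for a density bounded by
  \<open>M\<close>. It makes coordinate hyperplanes null and bounds the masses of cubes, which is
  how it enters the smoothing.\<close>

locale lc_bounded = prob_Rn n P for n P +
  fixes M :: real
  assumes lc: "log_concave n P" and M: "0 < M"
    and dominated: "\<And>A. A \<in> sets (leb n) \<Longrightarrow> emeasure P A \<le> ennreal M * emeasure (leb n) A"
begin

lemma coord_hyperplane_null_P:
  assumes "i < n"
  shows "emeasure P {x \<in> Rn n. x i = t} = 0"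
  using dominated[OF coord_hyperplane_sets[OF assms]] unfolding coord_hyperplane_null[OF assms] mult_zero_right le_zero_eq .

lemma log_concaveD:
  assumes "compact A" "compact B" "A \<subseteq> Rn n" "B \<subseteq> Rn n" "0 < l" "l < 1"
  shows "measure P A powr l * measure P B powr (1 - l) \<le> measure P (mink n l A B)"
  by (rule lc[unfolded log_concave_def, THEN conjunct2, THEN conjunct2, THEN conjunct1, THEN spec, THEN spec, THEN spec, THEN mp]) (simp only: assms simp_thms)

lemma log_concave_cube:
  assumes l: "0 < l" "l < 1"
  shows "measure P (cube n x r) powr l * measure P (cube n y r) powr (1 - l) \<le> measure P (cube n (cmb n l x y) r)"
proof -
  have "measure P (cube n x r) powr l * measure P (cube n y r) powr (1 - l)
      \<le> measure P (mink n l (cube n x r) (cube n y r))"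
    by (rule log_concaveD) (intro compact_cube cube_subset_Rn l)+
  also have "\<dots> \<le> measure P (cube n (cmb n l x y) r)"
    by (rule finite_measure_mono[OF mink_cube[OF l]]) simp
  finally show ?thesis .
qed

text \<open>The smoothed density at \<open>z\<close> is the mass of a cube centred at
  \<open>z\<close>, divided by its volume. Cubes of equal size combine into a cube of that size, so
  the set inequality for compact sets becomes pointwise log-concavity.\<close>

lemma lc_prob_smoothed:
  assumes r: "0 < r"
  shows "lc_prob n (conv n P (unif n r)) (\<lambda>z. measure P (cube n z r) / (2 * r) ^ n) M"
proof -
  interpret U: prob_Rn n "unif n r" using r by (rule prob_Rn_unif)
  interpret PU: prob_Rn_pair n P "unif n r" ..
  let ?q = "\<lambda>x. indicator (cube n (\<lambda>_. 0) r) x / (2 * r) ^ n :: real"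
  let ?G = "\<lambda>z. measure P (cube n z r) / (2 * r) ^ n"
  have c: "0 < (2 * r) ^ n" using r by simp
  have q: "?q (subv n z y) = indicator (cube n z r) y / (2 * r) ^ n" if "y \<in> Rn n" for z y
  proof -
    have "subv n z y \<in> cube n (\<lambda>_. 0) r \<longleftrightarrow> y \<in> cube n z r"
      using that by (simp add: cube_iff abs_minus_commute)
    then show ?thesis by (simp add: indicator_def)
  qed
  have G: "?G z = (\<integral>y. ?q (subv n z y) \<partial>P)" for z
  proof -
    have "(\<integral>y. ?q (subv n z y) \<partial>P) = (\<integral>y. indicator (cube n z r) y / (2 * r) ^ n \<partial>P)"
      by (rule Bochner_Integration.integral_cong[OF refl]) (simp only: q space_P)
    also have "\<dots> = ?G z" using cube_subset_Rn by (simp add: Int_absorb2)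
    finally show ?thesis by (rule sym)
  qed
  show ?thesis
  proof (unfold_locales)
    show "?G \<in> borel_measurable (leb n)" unfolding G
      by (rule borel_measurable_lebesgue_integral) measurable
    show "0 \<le> ?G z" for z using c by simp
    show "?G z \<le> M" for z
    proof -
      have "emeasure P (cube n z r) \<le> ennreal (M * (2 * r) ^ n)"
        using dominated[of "cube n z r"] r M by (simp add: emeasure_cube ennreal_mult')
      then have "measure P (cube n z r) \<le> M * (2 * r) ^ n"
        using M c by (simp add: emeasure_eq_measure)
      then show ?thesis using c by (simp add: field_simps)
    qed
    show "conv n P (unif n r) = density (leb n) (\<lambda>z. ennreal (?G z))"
      unfolding G
    proof (rule PU.conv_density)
      show "0 \<le> ?q x \<and> ?q x \<le> 1 / (2 * r) ^ n" for x using c by (simp add: indicator_def)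
    qed (simp_all add: unif_def)
    show "log_concave_fun n ?G"
      unfolding log_concave_fun_def
    proof (intro ballI allI impI, elim conjE)
      fix x y l assume l: "0 < l" "l < (1::real)"
      have "(2 * r) ^ n = ((2 * r) ^ n) powr l * ((2 * r) ^ n) powr (1 - l)"
        using c by (simp flip: powr_add)
      then have "?G x powr l * ?G y powr (1 - l) = measure P (cube n x r) powr l * measure P (cube n y r) powr (1 - l) / (2 * r) ^ n"
        using c by (simp add: powr_divide)
      also have "\<dots> \<le> ?G (cmb n l x y)"
        using log_concave_cube[OF l] c by (intro divide_right_mono) auto
      finally show "?G x powr l * ?G y powr (1 - l) \<le> ?G (cmb n l x y)" .
    qed
    show "seq_cont n ?G"
      unfolding seq_cont_def
    proof (intro allI impI, elim conjE)
      fix X x assume x: "x \<in> Rn n" and lim: "\<forall>i<n. (\<lambda>k. X k i) \<longlonglongrightarrow> x i"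
      have "(\<lambda>k. (\<integral>y. (indicator (cube n (X k) r) y :: real) \<partial>P)) \<longlonglongrightarrow> (\<integral>y. (indicator (cube n x r) y :: real) \<partial>P)"
      proof (rule integral_dominated_convergence[where w = "\<lambda>_. 1"])
        have null: "AE y in P. y i \<noteq> t" if "i < n" for i t
          by (rule AE_I[OF _ coord_hyperplane_null_P[OF that, of t]])
            (simp_all only: space_P not_not subset_refl sets_P coord_hyperplane_sets[OF that])
        \<comment> \<open>The exceptional set consists of the null hyperplanes through the faces of
          the limit cube. Elsewhere membership is decided by strict inequalities, which persist for
          large \<open>k\<close>, so the indicators are eventually constant.\<close>
        have "AE y in P. \<forall>i\<in>{..<n}. y i \<noteq> x i - r \<and> y i \<noteq> x i + r"
          using null by (intro AE_finite_allI AE_conjI) auto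
        then show "AE y in P. (\<lambda>k. indicator (cube n (X k) r) y) \<longlonglongrightarrow> (indicator (cube n x r) y :: real)"
        proof (rule AE_mp, intro AE_I2 impI)
          fix y assume y: "y \<in> space P" and ne: "\<forall>i\<in>{..<n}. y i \<noteq> x i - r \<and> y i \<noteq> x i + r"
          have ev: "\<forall>\<^sub>F k in sequentially. (\<bar>y i - X k i\<bar> \<le> r) = (\<bar>y i - x i\<bar> \<le> r)" if i: "i < n" for i
          proof -
            have l: "(\<lambda>k. \<bar>y i - X k i\<bar>) \<longlonglongrightarrow> \<bar>y i - x i\<bar>" using lim i by (intro tendsto_intros) auto
            have "y i \<noteq> x i - r" "y i \<noteq> x i + r" using ne i by simp_all
            then have "\<bar>y i - x i\<bar> \<noteq> r" by (simp add: abs_if)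
            then show ?thesis
            proof (cases rule: linorder_cases[of "\<bar>y i - x i\<bar>" r])
              case less
              from order_tendstoD(2)[OF l less] show ?thesis by eventually_elim (use less in simp)
            next
              case greater
              from order_tendstoD(1)[OF l greater] show ?thesis by eventually_elim (use greater in simp)
            qed simp
          qed
          have "\<forall>\<^sub>F k in sequentially. \<forall>i\<in>{..<n}. (\<bar>y i - X k i\<bar> \<le> r) = (\<bar>y i - x i\<bar> \<le> r)"
            using ev by (intro eventually_ball_finite) auto
          then have "\<forall>\<^sub>F k in sequentially. indicator (cube n (X k) r) y = (indicator (cube n x r) y :: real)"
            by eventually_elim (simp add: indicator_def cube_iff)
          then show "(\<lambda>k. indicator (cube n (X k) r) y) \<longlonglongrightarrow> (indicator (cube n x r) y :: real)"
            by (rule tendsto_eventually)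
        qed
      qed (simp_all add: indicator_def)
      then show "(\<lambda>k. ?G (X k)) \<longlonglongrightarrow> ?G x"
        using r cube_subset_Rn by (intro tendsto_divide tendsto_const) (simp_all add: Int_absorb2)
    qed
  qed
qed

end

section \<open>Sums of independent copies and second moments\<close>

context lc_bounded
begin

text \<open>Doubling starts from the smoothed law, so each of the \<open>2 ^ m\<close> copies
  carries its own cube variable: hence the factor 1/2 inside the power and the term with
  \<open>r\<close> inside the bracket. That term stays explicit so that \<open>r\<close> can be
  chosen later in terms of finitely many linear forms.\<close>

lemma sum_of_copies:
  assumes r: "0 < r"
    and int: "\<And>c. integrable P (\<lambda>x. (ip n c x)\<^sup>2)" and mean: "\<And>c. (\<integral>x. ip n c x \<partial>P) = 0"
  shows "\<exists>Q g. lc_prob n Q g M \<and>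
     (\<forall>c. integrable Q (\<lambda>x. (ip n c x)\<^sup>2) \<and> (\<integral>x. ip n c x \<partial>Q) = 0 \<and>
        (\<integral>x. (ip n c x)\<^sup>2 \<partial>Q) \<le> 2 ^ m * ((\<integral>x. (ip n c x)\<^sup>2 \<partial>P) + (r * (\<Sum>i<n. \<bar>c i\<bar>))\<^sup>2)) \<and>
     (\<forall>c t. (measure P {x \<in> Rn n. t \<le> ip n c x} / 2) ^ (2 ^ m) \<le> measure Q {x \<in> Rn n. 2 ^ m * t \<le> ip n c x})"
proof (induction m)
  case 0
  interpret U: prob_Rn n "unif n r" using r by (rule prob_Rn_unif)
  interpret PU: prob_Rn_pair n P "unif n r" ..
  show ?case
  proof (intro exI conjI allI)
    show "lc_prob n (conv n P (unif n r)) (\<lambda>z. measure P (cube n z r) / (2 * r) ^ n) M"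
      using r by (rule lc_prob_smoothed)
    fix c t
    note mc = PU.moments_conv[OF int mean unif_moments(1,2)[OF r], of c]
    show "integrable (conv n P (unif n r)) (\<lambda>x. (ip n c x)\<^sup>2)" "(\<integral>x. ip n c x \<partial>conv n P (unif n r)) = 0"
      by (rule mc)+
    show "(\<integral>x. (ip n c x)\<^sup>2 \<partial>conv n P (unif n r)) \<le> 2 ^ 0 * ((\<integral>x. (ip n c x)\<^sup>2 \<partial>P) + (r * (\<Sum>i<n. \<bar>c i\<bar>))\<^sup>2)"
      using mc(3) unif_moments(3)[OF r, of n c] by simp
    have "measure P {x \<in> Rn n. t \<le> ip n c x} * (1 / 2)
       \<le> measure P {x \<in> Rn n. t \<le> ip n c x} * measure (unif n r) {x \<in> Rn n. 0 \<le> ip n c x}"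
      by (intro mult_left_mono unif_halfspace[OF r]) simp
    also have "\<dots> \<le> measure (conv n P (unif n r)) {x \<in> Rn n. t + 0 \<le> ip n c x}"
      by (rule PU.halfspace_conv)
    finally show "(measure P {x \<in> Rn n. t \<le> ip n c x} / 2) ^ (2 ^ 0) \<le> measure (conv n P (unif n r)) {x \<in> Rn n. 2 ^ 0 * t \<le> ip n c x}"
      by simp
  qed
next
  case (Suc m)
  then obtain Q g where Q: "lc_prob n Q g M"
    and IH: "\<forall>c. integrable Q (\<lambda>x. (ip n c x)\<^sup>2) \<and> (\<integral>x. ip n c x \<partial>Q) = 0 \<and>
        (\<integral>x. (ip n c x)\<^sup>2 \<partial>Q) \<le> 2 ^ m * ((\<integral>x. (ip n c x)\<^sup>2 \<partial>P) + (r * (\<Sum>i<n. \<bar>c i\<bar>))\<^sup>2)"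
      "\<forall>c t. (measure P {x \<in> Rn n. t \<le> ip n c x} / 2) ^ (2 ^ m) \<le> measure Q {x \<in> Rn n. 2 ^ m * t \<le> ip n c x}"
    by (elim exE conjE) (rule that)
  note mom = IH(1)[THEN spec, THEN conjunct1] IH(1)[THEN spec, THEN conjunct2, THEN conjunct1]
    IH(1)[THEN spec, THEN conjunct2, THEN conjunct2]
  note half = IH(2)[THEN spec, THEN spec]
  interpret Q: lc_prob n Q g M by (rule Q)
  interpret QQ: prob_Rn_pair n Q Q ..
  show ?case
  proof (intro exI conjI allI)
    show "lc_prob n (conv n Q Q) (\<lambda>z. \<integral>y. g (subv n z y) \<partial>Q) M"
      by (rule Q.lc_prob_conv_self)
    fix c t
    note mc = QQ.moments_conv[OF mom(1,2) mom(1,2), of c]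
    show "integrable (conv n Q Q) (\<lambda>x. (ip n c x)\<^sup>2)" "(\<integral>x. ip n c x \<partial>conv n Q Q) = 0"
      by (rule mc)+
    show "(\<integral>x. (ip n c x)\<^sup>2 \<partial>conv n Q Q) \<le> 2 ^ Suc m * ((\<integral>x. (ip n c x)\<^sup>2 \<partial>P) + (r * (\<Sum>i<n. \<bar>c i\<bar>))\<^sup>2)"
      using mc(3) mom(3)[of c] by simp
    have "(measure P {x \<in> Rn n. t \<le> ip n c x} / 2) ^ (2 ^ Suc m)
       = (measure P {x \<in> Rn n. t \<le> ip n c x} / 2) ^ (2 ^ m) * (measure P {x \<in> Rn n. t \<le> ip n c x} / 2) ^ (2 ^ m)"
      by (simp only: power_Suc mult_2 power_add)
    also have "\<dots> \<le> measure Q {x \<in> Rn n. 2 ^ m * t \<le> ip n c x} * measure Q {x \<in> Rn n. 2 ^ m * t \<le> ip n c x}"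
      by (intro mult_mono half) simp_all
    also have "\<dots> \<le> measure (conv n Q Q) {x \<in> Rn n. 2 ^ m * t + 2 ^ m * t \<le> ip n c x}"
      by (rule QQ.halfspace_conv)
    also have "2 ^ m * t + 2 ^ m * t = 2 ^ Suc m * t" by simp
    finally show "(measure P {x \<in> Rn n. t \<le> ip n c x} / 2) ^ (2 ^ Suc m) \<le> measure (conv n Q Q) {x \<in> Rn n. 2 ^ Suc m * t \<le> ip n c x}" .
  qed
qed

section \<open>Exponential tails and finite second moments\<close>

lemma cube_exhausts: "(\<lambda>k. measure P (A \<inter> cube n (\<lambda>_. 0) (real k))) \<longlonglongrightarrow> measure P A"
  if [measurable]: "A \<in> sets (leb n)"
proof -
  have inc: "incseq (\<lambda>k. A \<inter> cube n (\<lambda>_. 0) (real k))"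
  proof (rule incseq_SucI, rule Int_mono[OF subset_refl], rule subsetI)
    fix k x assume "x \<in> cube n (\<lambda>_. 0) (real k)"
    then show "x \<in> cube n (\<lambda>_. 0) (real (Suc k))" by (fastforce simp only: cube_iff of_nat_Suc)
  qed
  have "(\<lambda>k. measure P (A \<inter> cube n (\<lambda>_. 0) (real k))) \<longlonglongrightarrow> measure P (\<Union>k. A \<inter> cube n (\<lambda>_. 0) (real k))"
  proof (rule finite_Lim_measure_incseq[OF _ inc], rule image_subsetI)
    fix k show "A \<inter> cube n (\<lambda>_. 0) (real k) \<in> sets P" by (simp add: sets.Int that)
  qed
  moreover have "(\<Union>k. A \<inter> cube n (\<lambda>_. 0) (real k)) = A"
  proof (rule equalityI)
    show "A \<subseteq> (\<Union>k. A \<inter> cube n (\<lambda>_. 0) (real k))"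
    proof
      fix x assume x: "x \<in> A"
      obtain k :: nat where k: "(\<Sum>i<n. \<bar>x i\<bar>) \<le> real k" using real_arch_simple by blast
      have "\<bar>x i - 0\<bar> \<le> real k" if "i < n" for i
        using k member_le_sum[of i "{..<n}" "\<lambda>i. \<bar>x i\<bar>"] that by simp
      moreover have "x \<in> Rn n" using x sets.sets_into_space[OF that] by (metis space_leb subsetD)
      ultimately have "x \<in> cube n (\<lambda>_. 0) (real k)" by (simp only: cube_iff) simp
      then show "x \<in> (\<Union>k. A \<inter> cube n (\<lambda>_. 0) (real k))" using x by blast
    qed
  qed blast
  ultimately show ?thesis by simp
qed

text \<open>Borell's argument: averaging a far set with a central cube of large mass lands outside the cube.\<close>

lemma coord_tail:
  assumes i: "i < n" and a: "0 < a" "3 / 4 \<le> measure P (cube n (\<lambda>_. 0) a)"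
  shows "measure P {x \<in> Rn n. real j * a \<le> \<bar>x i\<bar>} \<le> 3 * (3 / 5) ^ j"
proof (cases "j < 3")
  case True
  \<comment> \<open>The prefactor 3 makes the bound at least 27/25 here, so it is trivial; the
    averaging argument below needs a weight less than 1.\<close>
  then have "(3 / 5 :: real) ^ 2 \<le> (3 / 5) ^ j" by (intro power_decreasing) auto
  then have "1 \<le> 3 * (3 / 5 :: real) ^ j" by (simp add: power2_eq_square)
  then show ?thesis using prob_le_1 by (rule order_trans[rotated])
next
  case False
  \<comment> \<open>With weight \<open>2 / j\<close>, the far point contributes at least
    \<open>2 * a\<close> in coordinate \<open>i\<close>, and the central cube pulls it back by at
    most \<open>(1 - l) * a < a\<close>.\<close>
  define l where "l = 2 / real j"
  have l: "0 < l" "l < 1" using False by (auto simp: l_def)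
  let ?A = "cube n (\<lambda>_. 0) a" and ?T = "{x \<in> Rn n. real j * a \<le> \<bar>x i\<bar>}"
  note [measurable] = measurable_coord[OF i]
  have T: "?T \<in> sets (leb n)" unfolding space_leb[symmetric] by measurable
  \<comment> \<open>Log-concavity speaks of compact sets only, so the tail is truncated by cubes and
    the truncation removed in the limit.\<close>
  have "measure P (?T \<inter> cube n (\<lambda>_. 0) (real k)) \<le> (3 / 5) ^ j" for k
  proof -
    let ?B = "?T \<inter> cube n (\<lambda>_. 0) (real k)"
    have "closed {x :: nat \<Rightarrow> real. real j * a \<le> \<bar>x i\<bar>}"
      by (intro closed_Collect_le continuous_intros continuous_on_product_coordinates)
    moreover have "?B = cube n (\<lambda>_. 0) (real k) \<inter> {x. real j * a \<le> \<bar>x i\<bar>}"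
      using cube_subset_Rn by blast
    ultimately have "compact ?B" by (simp add: compact_Int_closed compact_cube)
    then have "measure P ?B powr l * measure P ?A powr (1 - l) \<le> measure P (mink n l ?B ?A)"
      using l cube_subset_Rn[of n "\<lambda>_. 0"] by (intro log_concaveD compact_cube) auto
    also have "\<dots> \<le> measure P (Rn n - ?A)"
    proof (rule finite_measure_mono)
      show "mink n l ?B ?A \<subseteq> Rn n - ?A"
      proof
        fix z assume "z \<in> mink n l ?B ?A"
        then obtain x y where z: "z = cmb n l x y" and x: "real j * a \<le> \<bar>x i\<bar>" and y: "y \<in> ?A"
          unfolding mink_def cmb_def by blast
        have "a < l * (real j * a) - (1 - l) * a" using False a by (simp add: l_def field_simps)
        also have "\<dots> \<le> l * \<bar>x i\<bar> - (1 - l) * \<bar>y i\<bar>"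
          using l x y i by (intro diff_mono mult_left_mono) (simp_all add: cube_iff)
        also have "\<dots> \<le> \<bar>l * x i + (1 - l) * y i\<bar>"
          using l abs_triangle_ineq2[of "l * x i" "- ((1 - l) * y i)"] by (simp add: abs_mult)
        finally have "\<not> \<bar>z i - 0\<bar> \<le> a" using i by (simp add: z)
        then have "z \<notin> ?A" using i by (simp only: cube_iff) blast
        moreover have "z \<in> Rn n" unfolding z by (rule cmb_in_Rn)
        ultimately show "z \<in> Rn n - ?A" by blast
      qed
      show "Rn n - ?A \<in> sets P" unfolding sets_P space_leb[symmetric] by measurable
    qed
    also have "\<dots> \<le> 1 / 4" using a prob_compl[of ?A] by simp
    finally have "measure P ?B powr l * measure P ?A powr (1 - l) \<le> 1 / 4" .
    moreover have "measure P ?B powr l * (3 / 4) \<le> measure P ?B powr l * measure P ?A powr (1 - l)"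
    proof (intro mult_left_mono)
      have "3 / 4 \<le> measure P ?A powr 1" using a by simp
      also have "\<dots> \<le> measure P ?A powr (1 - l)" using l a by (intro powr_mono') auto
      finally show "3 / 4 \<le> measure P ?A powr (1 - l)" .
    qed simp
    \<comment> \<open>The quotient of 1/4 by 3/4 is 1/3; it is rounded up to the square 9/25 so that
      the power \<open>j / 2\<close> is a power of 3/5.\<close>
    ultimately have "measure P ?B powr l \<le> 9 / 25" by simp
    then have "(measure P ?B powr l) powr (real j / 2) \<le> (9 / 25) powr (real j / 2)"
      by (intro powr_mono2) auto
    moreover have "l * (real j / 2) = 1" using False by (simp add: l_def)
    moreover have "(9 / 25 :: real) powr (real j / 2) = (3 / 5) ^ j"
    proof -
      have "(9 / 25 :: real) = (3 / 5) powr 2" by (simp add: power2_eq_square)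
      then have "(9 / 25 :: real) powr (real j / 2) = (3 / 5) powr real j" by (simp only: powr_powr) simp
      then show ?thesis by (simp add: powr_realpow)
    qed
    ultimately show ?thesis by (simp add: powr_powr)
  qed
  then have "measure P ?T \<le> (3 / 5) ^ j"
    by (intro LIMSEQ_le_const2[OF cube_exhausts[OF T]]) blast
  also have "\<dots> \<le> 3 * (3 / 5) ^ j" by simp
  finally show ?thesis .
qed

lemma summable_tail: "summable (\<lambda>j. (real j + 1)\<^sup>2 * (3 * (3 / 5) ^ j))"
proof (rule summable_ratio_test[where c = "9 / 10" and N = 4])
  fix j :: nat assume "4 \<le> j"
  define s where "s = real j * real j"
  have "4 * real j \<le> s" unfolding s_def using \<open>4 \<le> j\<close> by (intro mult_right_mono) auto
  moreover have "(real (Suc j) + 1)\<^sup>2 = s + 4 * real j + 4" "(real j + 1)\<^sup>2 = s + 2 * real j + 1"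
    by (simp_all add: s_def power2_eq_square algebra_simps)
  moreover have "4 \<le> real j" using \<open>4 \<le> j\<close> by simp
  ultimately have "(3 / 5) * (real (Suc j) + 1)\<^sup>2 \<le> 9 / 10 * (real j + 1)\<^sup>2" by linarith
  then have "((3 / 5) * (real (Suc j) + 1)\<^sup>2) * (3 * (3 / 5) ^ j) \<le> (9 / 10 * (real j + 1)\<^sup>2) * (3 * (3 / 5) ^ j)"
    by (rule mult_right_mono) simp
  then show "norm ((real (Suc j) + 1)\<^sup>2 * (3 * (3 / 5) ^ Suc j)) \<le> 9 / 10 * norm ((real j + 1)\<^sup>2 * (3 * (3 / 5) ^ j))"
    by (simp add: abs_mult mult_ac)
qed simp

text \<open>Splitting by the integer part of \<open>\<bar>x i\<bar> / a\<close> compares the second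
  moment with a convergent series of tails. This must be proved, since a divergent integral would
  enter the covariance matrix with the default value 0.\<close>

lemma coord_square_integrable:
  assumes i: "i < n"
  shows "integrable P (\<lambda>x. (x i)\<^sup>2)"
proof -
  have "(\<lambda>k. measure P (cube n (\<lambda>_. 0) (real k))) \<longlonglongrightarrow> 1"
    using cube_exhausts[of "Rn n"] cube_subset_Rn sets.top[of "leb n"] unfolding space_leb by (simp add: Int_absorb1)
  then have "\<forall>\<^sub>F k in sequentially. 3 / 4 < measure P (cube n (\<lambda>_. 0) (real k))"
    by (rule order_tendstoD) simp
  then have "\<forall>\<^sub>F k in sequentially. 3 / 4 < measure P (cube n (\<lambda>_. 0) (real k)) \<and> 0 < k"
    using eventually_gt_at_top by (rule eventually_conj)
  then obtain k where k: "3 / 4 < measure P (cube n (\<lambda>_. 0) (real k))" "0 < k"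
    using eventually_happens'[OF sequentially_bot] by blast
  define a where "a = real k"
  have a: "0 < a" "3 / 4 \<le> measure P (cube n (\<lambda>_. 0) a)" using k by (auto simp: a_def)
  have le_suminf: "f j \<le> (\<Sum>j. f j)" for f :: "nat \<Rightarrow> ennreal" and j
    using sum_le_suminf[OF summableI, of "{j}" f] by simp
  let ?T = "\<lambda>j. {x \<in> Rn n. real j * a \<le> \<bar>x i\<bar>}"
  note xi [measurable] = measurable_coord[OF i]
  have T [measurable]: "?T j \<in> sets (leb n)" for j unfolding space_leb[symmetric] by measurable
  have "(\<integral>\<^sup>+x. ennreal ((x i)\<^sup>2) \<partial>P) \<le> (\<integral>\<^sup>+x. (\<Sum>j. ennreal ((real j + 1)\<^sup>2 * a\<^sup>2) * indicator (?T j) x) \<partial>P)"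
  proof (rule nn_integral_mono)
    fix x assume "x \<in> space P"
    then have x: "x \<in> Rn n" by (simp only: space_P)
    define j where "j = nat \<lfloor>\<bar>x i\<bar> / a\<rfloor>"
    have j: "real j \<le> \<bar>x i\<bar> / a" "\<bar>x i\<bar> / a < real j + 1" using a by (auto simp: j_def)
    then have j': "real j * a \<le> \<bar>x i\<bar>" "\<bar>x i\<bar> \<le> (real j + 1) * a" using a by (auto simp: field_simps)
    then have "\<bar>x i\<bar> \<le> \<bar>(real j + 1) * a\<bar>" using a by simp
    then have "(x i)\<^sup>2 \<le> (real j + 1)\<^sup>2 * a\<^sup>2" by (simp only: abs_le_square_iff power_mult_distrib)
    then have "ennreal ((x i)\<^sup>2) \<le> ennreal ((real j + 1)\<^sup>2 * a\<^sup>2) * indicator (?T j) x"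
      using j' x by (simp add: ennreal_leI)
    also have "\<dots> \<le> (\<Sum>j. ennreal ((real j + 1)\<^sup>2 * a\<^sup>2) * indicator (?T j) x)"
      by (rule le_suminf)
    finally show "ennreal ((x i)\<^sup>2) \<le> (\<Sum>j. ennreal ((real j + 1)\<^sup>2 * a\<^sup>2) * indicator (?T j) x)" .
  qed
  also have "\<dots> = (\<Sum>j. \<integral>\<^sup>+x. ennreal ((real j + 1)\<^sup>2 * a\<^sup>2) * indicator (?T j) x \<partial>P)"
    by (rule nn_integral_suminf) measurable
  also have "\<dots> \<le> (\<Sum>j. ennreal (a\<^sup>2 * ((real j + 1)\<^sup>2 * (3 * (3 / 5) ^ j))))"
  proof (rule suminf_le)
    fix j
    have "(\<integral>\<^sup>+x. ennreal ((real j + 1)\<^sup>2 * a\<^sup>2) * indicator (?T j) x \<partial>P) = ennreal ((real j + 1)\<^sup>2 * a\<^sup>2) * emeasure P (?T j)"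
      using T by (intro nn_integral_cmult_indicator) simp
    also have "\<dots> = ennreal (a\<^sup>2 * ((real j + 1)\<^sup>2 * measure P (?T j)))"
      by (simp add: emeasure_eq_measure mult_ac flip: ennreal_mult')
    also have "\<dots> \<le> ennreal (a\<^sup>2 * ((real j + 1)\<^sup>2 * (3 * (3 / 5) ^ j)))"
      by (intro ennreal_leI mult_left_mono coord_tail[OF i a]) simp_all
    finally show "(\<integral>\<^sup>+x. ennreal ((real j + 1)\<^sup>2 * a\<^sup>2) * indicator (?T j) x \<partial>P) \<le> ennreal (a\<^sup>2 * ((real j + 1)\<^sup>2 * (3 * (3 / 5) ^ j)))" .
  qed simp_all
  also have "\<dots> < \<infinity>"
    using summable_mult[OF summable_tail, of "a\<^sup>2"] by (subst suminf_ennreal2) auto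
  finally show ?thesis by (intro integrableI_nonneg) auto
qed

end

section \<open>Level sets\<close>

text \<open>The normal \<open>c\<close> points from the nearest point \<open>p\<close> of
  \<open>K\<close> to \<open>z\<close>. Convexity and closedness are assumed in the coordinatewise
  form in which level sets of a density supply them.\<close>

lemma separation:
  assumes sub: "K \<subseteq> Rn n" and ne: "K \<noteq> {}"
    and conv: "\<And>x y l. x \<in> K \<Longrightarrow> y \<in> K \<Longrightarrow> 0 < l \<Longrightarrow> l < 1 \<Longrightarrow> cmb n l x y \<in> K"
    and closed: "\<And>X x. (\<And>k::nat. X k \<in> K) \<Longrightarrow> x \<in> Rn n \<Longrightarrow> (\<And>i. i < n \<Longrightarrow> (\<lambda>k. X k i) \<longlonglongrightarrow> x i) \<Longrightarrow> x \<in> K"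
    and z: "z \<in> Rn n" "z \<notin> K"
  shows "\<exists>c\<in>Rn n. (\<exists>i<n. c i \<noteq> 0) \<and> (\<forall>y\<in>K. ip n c y < ip n c z)"
proof -
  define N where "N y = (\<Sum>i<n. (y i - z i)\<^sup>2)" for y :: "nat \<Rightarrow> real"
  define d where "d = Inf (N ` K)"
  have N0: "0 \<le> N y" for y by (simp add: N_def sum_nonneg)
  have bdd: "bdd_below (N ` K)" using N0 by (intro bdd_belowI[of _ 0]) blast
  have d_le: "d \<le> N y" if "y \<in> K" for y unfolding d_def using that by (intro cInf_lower bdd imageI)
  have "\<exists>y\<in>K. N y < d + 1 / real (Suc k)" for k
  proof -
    have "Inf (N ` K) < d + 1 / real (Suc k)" by (simp add: d_def)
    then obtain t where "t \<in> N ` K" "t < d + 1 / real (Suc k)"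
      using cInf_lessD[of "N ` K"] ne by (metis image_is_empty)
    then show ?thesis by blast
  qed
  then obtain Y where Y: "\<And>k. Y k \<in> K" "\<And>k. N (Y k) < d + 1 / real (Suc k)" by metis
  have Yd: "N (Y k) - d < 1 / real (Suc k)" for k
    using Y(2)[of k] by (simp only: diff_less_eq add.commute[of d])
  \<comment> \<open>The parallelogram law, with the midpoint still in \<open>K\<close>: almost
    minimal points are close to each other, so a minimizing sequence is Cauchy.\<close>
  have par: "(\<Sum>i<n. (x i - y i)\<^sup>2) \<le> 2 * (N x - d) + 2 * (N y - d)" if "x \<in> K" "y \<in> K" for x y
  proof -
    have "(\<Sum>i<n. (x i - y i)\<^sup>2) = 2 * N x + 2 * N y - 4 * N (cmb n (1 / 2) x y)"
      unfolding N_def sum_distrib_left sum.distrib[symmetric] sum_subtractf[symmetric]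
      by (intro sum.cong refl) (simp add: power2_eq_square field_simps)
    moreover have "d \<le> N (cmb n (1 / 2) x y)" by (intro d_le conv that) simp_all
    ultimately show ?thesis by simp
  qed
  have "convergent (\<lambda>k. Y k i)" if i: "i < n" for i
  proof (rule Cauchy_convergent, rule CauchyI)
    fix e :: real assume e: "0 < e"
    obtain m where m: "4 / e\<^sup>2 < real (Suc m)" using reals_Archimedean2[of "4 / e\<^sup>2"] by (metis less_trans lessI of_nat_less_iff)
    have "norm (Y k i - Y l i) < e" if kl: "m \<le> k" "m \<le> l" for k l
    proof -
      have "(Y k i - Y l i)\<^sup>2 \<le> (\<Sum>i<n. (Y k i - Y l i)\<^sup>2)"
        using i by (intro member_le_sum) auto
      also have "\<dots> \<le> 2 * (N (Y k) - d) + 2 * (N (Y l) - d)" by (intro par Y)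
      also have "\<dots> < 2 * (1 / real (Suc k)) + 2 * (1 / real (Suc l))"
        by (intro add_strict_mono mult_strict_left_mono Yd) simp_all
      also have "\<dots> \<le> 2 * (1 / real (Suc m)) + 2 * (1 / real (Suc m))"
        using kl by (intro add_mono mult_left_mono divide_left_mono) simp_all
      also have "\<dots> = 4 / real (Suc m)" by simp
      also have "\<dots> < e\<^sup>2" using m e by (simp add: field_simps)
      finally have "\<bar>Y k i - Y l i\<bar>\<^sup>2 < e\<^sup>2" by simp
      from power_less_imp_less_base[OF this] show ?thesis using e by simp
    qed
    then show "\<exists>M. \<forall>k\<ge>M. \<forall>l\<ge>M. norm (Y k i - Y l i) < e" by blast
  qed
  then have "\<forall>i\<in>{..<n}. \<exists>L. (\<lambda>k. Y k i) \<longlonglongrightarrow> L" by (simp add: convergent_def)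
  then obtain q where q: "\<forall>i\<in>{..<n}. (\<lambda>k. Y k i) \<longlonglongrightarrow> q i" by metis
  define p where "p = restrict q {..<n}"
  have p: "p \<in> Rn n" by (simp add: p_def)
  have lim: "(\<lambda>k. Y k i) \<longlonglongrightarrow> p i" if "i < n" for i using q that by (simp add: p_def)
  have pK: "p \<in> K" by (rule closed[OF Y(1) p lim])
  have "(\<lambda>k. N (Y k)) \<longlonglongrightarrow> N p" unfolding N_def by (intro tendsto_intros lim) simp
  moreover have "(\<lambda>k. d + 1 / real (Suc k)) \<longlonglongrightarrow> d + 0"
    by (intro tendsto_add tendsto_const LIMSEQ_Suc[OF lim_1_over_n])
  ultimately have Np: "N p \<le> d" using Y(2) by (intro LIMSEQ_le[of _ "N p" _ d]) (auto intro: less_imp_le)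
  define c where "c = restrict (\<lambda>i. z i - p i) {..<n}"
  have ci: "c i = z i - p i" if "i < n" for i using that by (simp add: c_def)
  have "p \<noteq> z" using pK z by blast
  then obtain i where i: "i < n" "c i \<noteq> 0" using Rn_eqI[OF p z(1)] ci by (metis right_minus_eq)
  have cc: "0 < (\<Sum>i<n. (c i)\<^sup>2)" using i by (intro sum_pos2[of _ i]) auto
  have "ip n c y < ip n c z" if y: "y \<in> K" for y
  proof -
    define S where "S = (\<Sum>i<n. c i * (y i - p i))"
    define T where "T = (\<Sum>i<n. (y i - p i)\<^sup>2)"
    have T: "0 \<le> T" by (simp add: T_def sum_nonneg)
    \<comment> \<open>Moving from \<open>p\<close> towards \<open>y\<close> by a fraction
      \<open>l\<close> stays in \<open>K\<close> and cannot decrease the distance to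
      \<open>z\<close>; small \<open>l\<close> then gives the obtuse angle condition
      \<open>S \<le> 0\<close>.\<close>
    have key: "2 * S \<le> l * T" if l: "0 < l" "l < 1" for l
    proof -
      have "N (cmb n l y p) = N p - 2 * l * S + l\<^sup>2 * T"
        unfolding N_def S_def T_def sum_distrib_left sum.distrib[symmetric] sum_subtractf[symmetric]
        by (intro sum.cong refl) (simp add: ci power2_eq_square algebra_simps)
      moreover have "d \<le> N (cmb n l y p)" by (intro d_le conv y pK l)
      ultimately have "l * (2 * S) \<le> l * (l * T)" using Np by (simp add: power2_eq_square)
      then show ?thesis using l by simp
    qed
    have "S \<le> 0"
    proof (rule ccontr)
      assume S: "\<not> S \<le> 0"
      \<comment> \<open>Small enough that the quadratic term \<open>l * T\<close> stays below
        \<open>S\<close>, against the factor 2 in front of \<open>S\<close>; \<open>T + 1\<close>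
        avoids division by zero.\<close>
      define l where "l = min (1 / 2) (S / (T + 1))"
      have "0 < l" "l < 1" using S T by (auto simp: l_def)
      from key[OF this] have "2 * S \<le> l * T" .
      also have "\<dots> \<le> S / (T + 1) * T" using T by (intro mult_right_mono) (auto simp: l_def)
      also have "\<dots> \<le> S" using S T by (simp add: field_simps)
      finally show False using S by simp
    qed
    moreover have "ip n c z - ip n c y = (\<Sum>i<n. (c i)\<^sup>2) - S"
      unfolding ip_def S_def sum_subtractf[symmetric]
      by (intro sum.cong refl) (simp add: ci power2_eq_square algebra_simps)
    ultimately show ?thesis using cc by linarith
  qed
  moreover have "c \<in> Rn n" by (simp add: c_def)
  ultimately show ?thesis using i by blast
qed

context lc_prob
begin

lemma g_lcD:
  "x \<in> Rn n \<Longrightarrow> y \<in> Rn n \<Longrightarrow> 0 < l \<Longrightarrow> l < 1 \<Longrightarrow> g x powr l * g y powr (1 - l) \<le> g (cmb n l x y)"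
  using g_lc unfolding log_concave_fun_def by simp

text \<open>The 4 in the threshold: off \<open>K\<close>, the square root from midpoint
  log-concavity leaves exp(-2n), and integrating \<open>g\<close> at midpoints with
  \<open>x0\<close> costs 2^n, at most exp(n). The volume bound is Markov's inequality. The point
  \<open>x0\<close> need not be a maximum of \<open>g\<close>.\<close>

lemma level_set:
  assumes x0: "x0 \<in> Rn n" and pos: "0 < g x0"
  defines "\<theta> \<equiv> exp (- 4 * real n) * g x0"
  defines "K \<equiv> {x \<in> Rn n. \<theta> \<le> g x}"
  shows "K \<in> sets (leb n)" and "emeasure (leb n) K \<le> ennreal (1 / \<theta>)"
    and "measure P (Rn n - K) \<le> exp (- real n)"
    and "\<And>z. z \<in> Rn n \<Longrightarrow> z \<notin> K \<Longrightarrow> \<exists>c\<in>Rn n. (\<exists>i<n. c i \<noteq> 0) \<and> (\<forall>y\<in>K. ip n c y < ip n c z)"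
proof -
  have \<theta>: "0 < \<theta>" using pos by (simp add: \<theta>_def)
  show K [measurable]: "K \<in> sets (leb n)" unfolding K_def space_leb[symmetric] by measurable
  have "ennreal \<theta> * emeasure (leb n) K = (\<integral>\<^sup>+x. ennreal \<theta> * indicator K x \<partial>leb n)"
    by (simp add: nn_integral_cmult_indicator)
  also have "\<dots> \<le> (\<integral>\<^sup>+x. ennreal (g x) * indicator K x \<partial>leb n)"
    by (intro nn_integral_mono) (simp add: K_def indicator_def ennreal_leI)
  also have "\<dots> = emeasure P K" unfolding P_density by (rule emeasure_density[symmetric]) measurable
  also have "\<dots> \<le> 1" by (rule emeasure_le_1)
  finally have le1: "ennreal \<theta> * emeasure (leb n) K \<le> 1" .
  have "emeasure (leb n) K = ennreal (1 / \<theta>) * (ennreal \<theta> * emeasure (leb n) K)"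
    using \<theta> by (simp add: mult.assoc[symmetric] flip: ennreal_mult')
  also have "\<dots> \<le> ennreal (1 / \<theta>) * 1" using le1 by (rule mult_left_mono) simp
  finally show "emeasure (leb n) K \<le> ennreal (1 / \<theta>)" by simp
  have total: "(\<integral>\<^sup>+x. ennreal (g x) \<partial>leb n) = 1"
  proof -
    have "(\<integral>\<^sup>+x. ennreal (g x) \<partial>leb n) = (\<integral>\<^sup>+x. 1 \<partial>P)"
      unfolding P_density by (subst nn_integral_density) simp_all
    then show ?thesis using emeasure_space_1 by simp
  qed
  have "emeasure P (Rn n - K) = (\<integral>\<^sup>+x. ennreal (g x) * indicator (Rn n - K) x \<partial>leb n)"
    unfolding P_density by (rule emeasure_density) (use sets.compl_sets[OF K] in \<open>simp_all add: space_leb\<close>)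
  also have "\<dots> \<le> (\<integral>\<^sup>+x. ennreal (exp (- 2 * real n)) * ennreal (g (affv n (\<lambda>i. x0 i / 2) (1 / 2) x)) \<partial>leb n)"
  proof (rule nn_integral_mono)
    fix x :: "nat \<Rightarrow> real" assume "x \<in> space (leb n)"
    then have x: "x \<in> Rn n" by (simp add: space_leb)
    show "ennreal (g x) * indicator (Rn n - K) x \<le> ennreal (exp (- 2 * real n)) * ennreal (g (affv n (\<lambda>i. x0 i / 2) (1 / 2) x))"
    proof (cases "x \<in> K")
      case False
      then have lt: "g x < \<theta>" using x by (simp add: K_def)
      have "g x = sqrt (g x) * sqrt (g x)" using g_nonneg[OF x] by simp
      also have "\<dots> \<le> sqrt \<theta> * sqrt (g x)" using lt g_nonneg[OF x] by (intro mult_right_mono) auto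
      also have "sqrt \<theta> = exp (- 2 * real n) * sqrt (g x0)"
      proof -
        have "exp (- 4 * real n) = (exp (- 2 * real n))\<^sup>2" by (simp add: power2_eq_square flip: exp_add)
        then show ?thesis by (simp add: \<theta>_def real_sqrt_mult)
      qed
      also have "exp (- 2 * real n) * sqrt (g x0) * sqrt (g x) = exp (- 2 * real n) * (g x powr (1 / 2) * g x0 powr (1 - 1 / 2))"
        using g_nonneg[OF x] pos by (simp add: powr_half_sqrt)
      also have "\<dots> \<le> exp (- 2 * real n) * g (cmb n (1 / 2) x x0)"
        by (intro mult_left_mono g_lcD x x0) simp_all
      also have "cmb n (1 / 2) x x0 = affv n (\<lambda>i. x0 i / 2) (1 / 2) x"
        by (rule Rn_eqI[OF cmb_in_Rn vec_in_Rn(3)]) simp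
      finally have "ennreal (g x) \<le> ennreal (exp (- 2 * real n)) * ennreal (g (affv n (\<lambda>i. x0 i / 2) (1 / 2) x))"
        by (simp add: ennreal_leI flip: ennreal_mult')
      then show ?thesis using x False by (simp add: indicator_def)
    qed (simp add: indicator_def)
  qed
  also have "\<dots> = ennreal (exp (- 2 * real n)) * (\<integral>\<^sup>+x. ennreal (g (affv n (\<lambda>i. x0 i / 2) (1 / 2) x)) \<partial>leb n)"
    by (rule nn_integral_cmult) measurable
  also have "(\<integral>\<^sup>+x. ennreal (g (affv n (\<lambda>i. x0 i / 2) (1 / 2) x)) \<partial>leb n) = ennreal (2 ^ n)"
  proof -
    let ?I = "\<integral>\<^sup>+x. ennreal (g (affv n (\<lambda>i. x0 i / 2) (1 / 2) x)) \<partial>leb n"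
    have "1 = ennreal ((1 / 2) ^ n) * ?I"
      using nn_integral_leb_affine[of "\<lambda>x. ennreal (g x)" n "1 / 2" "\<lambda>i. x0 i / 2"] total by simp
    then have "ennreal (2 ^ n) * 1 = ennreal (2 ^ n) * (ennreal ((1 / 2) ^ n) * ?I)" by simp
    also have "\<dots> = ennreal (2 ^ n * (1 / 2) ^ n) * ?I" by (simp add: mult.assoc ennreal_mult')
    also have "2 ^ n * (1 / 2) ^ n = (1 :: real)" by (simp flip: power_mult_distrib)
    finally show ?thesis by simp
  qed
  also have "ennreal (exp (- 2 * real n)) * ennreal (2 ^ n) \<le> ennreal (exp (- real n))"
  proof -
    have "(2::real) ^ n \<le> exp 1 ^ n" using exp_ge_add_one_self[of 1] by (intro power_mono) auto
    also have "\<dots> = exp (real n)" by (simp flip: exp_of_nat_mult)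
    finally have "exp (- 2 * real n) * 2 ^ n \<le> exp (- 2 * real n) * exp (real n)" by (intro mult_left_mono) simp_all
    also have "\<dots> = exp (- real n)" by (simp flip: exp_add)
    finally show ?thesis by (simp add: ennreal_leI flip: ennreal_mult')
  qed
  finally show "measure P (Rn n - K) \<le> exp (- real n)" by (simp add: emeasure_eq_measure)
  show "\<exists>c\<in>Rn n. (\<exists>i<n. c i \<noteq> 0) \<and> (\<forall>y\<in>K. ip n c y < ip n c z)" if z: "z \<in> Rn n" "z \<notin> K" for z
  proof (rule separation)
    show "K \<subseteq> Rn n" by (simp add: K_def)
    have "\<theta> \<le> 1 * g x0" unfolding \<theta>_def using pos by (intro mult_right_mono) auto
    then have "x0 \<in> K" using x0 by (simp add: K_def)
    then show "K \<noteq> {}" by blast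
    show "cmb n l x y \<in> K" if "x \<in> K" "y \<in> K" "0 < l" "l < 1" for x y l
    proof -
      have "\<theta> = \<theta> powr l * \<theta> powr (1 - l)" using \<theta> by (simp flip: powr_add)
      also have "\<dots> \<le> g x powr l * g y powr (1 - l)"
        using that \<theta> by (intro mult_mono powr_mono2) (auto simp: K_def)
      also have "\<dots> \<le> g (cmb n l x y)" using that by (intro g_lcD) (simp_all add: K_def)
      finally show ?thesis by (simp add: K_def)
    qed
    show "x \<in> K" if X: "\<And>k::nat. X k \<in> K" "x \<in> Rn n" "\<And>i. i < n \<Longrightarrow> (\<lambda>k. X k i) \<longlonglongrightarrow> x i" for X x
    proof -
      have "(\<lambda>k. g (X k)) \<longlonglongrightarrow> g x"
        using g_cont[unfolded seq_cont_def, rule_format, of X x] X by (simp add: K_def)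
      moreover have "\<theta> \<le> g (X k)" for k using X(1)[of k] by (simp add: K_def)
      ultimately have "\<theta> \<le> g x" by (intro LIMSEQ_le_const) auto
      then show ?thesis using X(2) by (simp add: K_def)
    qed
  qed (rule z)+
qed

end

section \<open>Density at the mode and covariance\<close>

text \<open>Column elimination: \<open>w\<close> expresses the last column through the leading
  block, and what remains in the corner is the Schur complement.\<close>

lemma det_bordered:
  fixes A :: "nat \<Rightarrow> nat \<Rightarrow> real"
  assumes det: "det (mat k k (\<lambda>(i, j). A i j)) \<noteq> 0"
  shows "\<exists>w. (\<forall>i<k. (\<Sum>j<k. A i j * w j) = A i k) \<and>
     det (mat (Suc k) (Suc k) (\<lambda>(i, j). A i j)) = det (mat k k (\<lambda>(i, j). A i j)) * (A k k - (\<Sum>j<k. A k j * w j))"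
proof -
  define B where "B = mat k k (\<lambda>(i, j). A i j)"
  define b where "b = mat k 1 (\<lambda>(i, j). A i k)"
  define r where "r = mat 1 k (\<lambda>(i, j). A k j)"
  have car: "B \<in> carrier_mat k k" "b \<in> carrier_mat k 1" "r \<in> carrier_mat 1 k" by (auto simp: B_def b_def r_def)
  from det_non_zero_imp_unit[OF car(1)] det obtain C where C: "C \<in> carrier_mat k k" "B * C = 1\<^sub>m k"
    unfolding Units_def B_def by (auto simp: ring_mat_simps)
  define W where "W = C * b"
  have W: "W \<in> carrier_mat k 1" using C car by (simp add: W_def)
  have BW: "B * W = b" using car C by (simp add: W_def flip: assoc_mult_mat[OF car(1) C(1) car(2)])
  define w where "w j = W $$ (j, 0)" for j
  have sol: "(\<Sum>j<k. A i j * w j) = A i k" if "i < k" for i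
  proof -
    have "(B * W) $$ (i, 0) = (\<Sum>j<k. A i j * w j)"
      using that W by (simp add: B_def w_def scalar_prod_def atLeast0LessThan)
    then show ?thesis using that by (simp add: BW b_def)
  qed
  define d where "d = A k k - (\<Sum>j<k. A k j * w j)"
  define D where "D = mat 1 1 (\<lambda>_. d)"
  have D: "D \<in> carrier_mat 1 1" by (simp add: D_def)
  have "mat (Suc k) (Suc k) (\<lambda>(i, j). A i j) = four_block_mat B b r (mat 1 1 (\<lambda>_. A k k))"
    by (rule eq_matI) (auto simp: B_def b_def r_def less_Suc_eq)
  also have "\<dots> = four_block_mat B (0\<^sub>m k 1) r D * four_block_mat (1\<^sub>m k) W (0\<^sub>m 1 k) (1\<^sub>m 1)"
  proof -
    have "r * W + D = mat 1 1 (\<lambda>_. A k k)"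
      using W by (intro eq_matI) (auto simp: r_def D_def d_def w_def scalar_prod_def atLeast0LessThan)
    then show ?thesis
      using car W D by (subst mult_four_block_mat[OF car(1) zero_carrier_mat car(3) D one_carrier_mat W zero_carrier_mat one_carrier_mat])
        (simp add: BW)
  qed
  finally have "det (mat (Suc k) (Suc k) (\<lambda>(i, j). A i j))
     = det (four_block_mat B (0\<^sub>m k 1) r D) * det (four_block_mat (1\<^sub>m k) W (0\<^sub>m 1 k) (1\<^sub>m 1))"
    using det_mult[OF four_block_carrier_mat[OF car(1) D] four_block_carrier_mat[OF one_carrier_mat one_carrier_mat]]
    by simp
  also have "det (four_block_mat B (0\<^sub>m k 1) r D) = det B * d"
    using det_four_block_mat_upper_right_zero_col[OF car(1) refl car(3) D] by (simp add: D_def det_single)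
  also have "det (four_block_mat (1\<^sub>m k) W (0\<^sub>m 1 k) (1\<^sub>m 1)) = 1"
    using det_four_block_mat_lower_left_zero[OF one_carrier_mat W refl one_carrier_mat] by simp
  finally show ?thesis using sol unfolding B_def d_def by (intro exI[of _ w]) simp
qed

text \<open>\<open>tri v i x\<close> is the i-th coordinate minus a combination of the previous ones, as in Gram-Schmidt.
  The unit triangular shape makes the change of variables volume preserving, and the residual variances
  multiply to the determinant of the covariance matrix.\<close>

definition tri :: "(nat \<Rightarrow> nat \<Rightarrow> real) \<Rightarrow> nat \<Rightarrow> (nat \<Rightarrow> real) \<Rightarrow> real" where
  "tri v i x = x i - (\<Sum>j<i. v i j * x j)"

definition tri_coeff :: "(nat \<Rightarrow> nat \<Rightarrow> real) \<Rightarrow> nat \<Rightarrow> nat \<Rightarrow> real" where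
  "tri_coeff v i j = (if j = i then 1 else if j < i then - v i j else 0)"

lemma tri_eq_ip:
  assumes "i < n"
  shows "tri v i x = ip n (tri_coeff v i) x"
proof -
  have "ip n (tri_coeff v i) x = (\<Sum>j\<in>{..<Suc i}. tri_coeff v i j * x j)"
    unfolding ip_def using assms by (intro sum.mono_neutral_right) (auto simp: tri_coeff_def)
  also have "\<dots> = (\<Sum>j<i. - (v i j * x j)) + x i"
    unfolding sum.lessThan_Suc by (intro arg_cong2[where f = plus] sum.cong) (auto simp: tri_coeff_def)
  finally show ?thesis by (simp add: tri_def sum_negf)
qed

text \<open>When the last coordinate is integrated first, the earlier coordinates only shift the
  mean of a one-dimensional Gaussian, which does not affect its integral.\<close>

lemma nn_integral_triangular_gaussian:
  assumes "\<And>i. i < n \<Longrightarrow> 0 < s i"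
  shows "(\<integral>\<^sup>+x. (\<Prod>i<n. ennreal (exp (- (tri v i x)\<^sup>2 / (2 * s i)))) \<partial>leb n) = (\<Prod>i<n. ennreal (sqrt (2 * pi * s i)))"
  using assms
proof (induction n)
  case 0
  then show ?case by (simp add: PiM_empty nn_integral_count_space_finite)
next
  case (Suc n)
  have tri_meas: "tri v i \<in> borel_measurable (leb m)" if "i < m" for i m
  proof -
    have "tri v i = ip m (tri_coeff v i)" using tri_eq_ip[OF that] by (simp add: fun_eq_iff)
    then show ?thesis by simp
  qed
  have gauss: "(\<integral>\<^sup>+t. ennreal (exp (- (t - a)\<^sup>2 / (2 * s n))) \<partial>lborel) = ennreal (sqrt (2 * pi * s n))" for a
  proof -
    have s: "0 < s n" using Suc.prems by simp
    have "exp (- (t - a)\<^sup>2 / (2 * s n)) = sqrt (2 * pi * s n) * normal_density a (sqrt (s n)) t" for t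
      using s by (simp add: normal_density_def real_sqrt_mult)
    then have "(\<integral>\<^sup>+t. ennreal (exp (- (t - a)\<^sup>2 / (2 * s n))) \<partial>lborel)
        = ennreal (\<integral>t. sqrt (2 * pi * s n) * normal_density a (sqrt (s n)) t \<partial>lborel)"
      using s by (simp only:) (intro nn_integral_eq_integral, auto)
    then show ?thesis using s by simp
  qed
  let ?q = "\<lambda>n x. \<Prod>i<n. ennreal (exp (- (tri v i x)\<^sup>2 / (2 * s i)))"
  have meas: "?q m \<in> borel_measurable (leb m)" for m
  proof (rule borel_measurable_prod_ennreal)
    fix i assume "i \<in> {..<m}"
    then have [measurable]: "tri v i \<in> borel_measurable (leb m)" by (intro tri_meas) simp
    show "(\<lambda>x. ennreal (exp (- (tri v i x)\<^sup>2 / (2 * s i)))) \<in> borel_measurable (leb m)" by measurable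
  qed
  have upd: "?q (Suc n) (x(n := t)) = ?q n x * ennreal (exp (- (t - (\<Sum>j<n. v n j * x j))\<^sup>2 / (2 * s n)))" for x t
  proof -
    have "tri v i (x(n := t)) = tri v i x" if "i < n" for i
      unfolding tri_def using that by (intro arg_cong2[where f = minus] sum.cong) auto
    moreover have "tri v n (x(n := t)) = t - (\<Sum>j<n. v n j * x j)"
      unfolding tri_def by (intro arg_cong2[where f = minus] sum.cong) auto
    ultimately show ?thesis unfolding prod.lessThan_Suc by simp
  qed
  have "(\<integral>\<^sup>+x. ?q (Suc n) x \<partial>leb (Suc n)) = (\<integral>\<^sup>+x. (\<integral>\<^sup>+t. ?q (Suc n) (x(n := t)) \<partial>lborel) \<partial>leb n)"
    unfolding leb_Suc using meas[of "Suc n"] by (intro lebs.product_nn_integral_insert) (simp_all only: leb_Suc, simp_all)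
  also have "\<dots> = (\<integral>\<^sup>+x. ?q n x * ennreal (sqrt (2 * pi * s n)) \<partial>leb n)"
    unfolding upd by (subst nn_integral_cmult) (simp_all only: gauss, measurable)
  also have "\<dots> = (\<integral>\<^sup>+x. ?q n x \<partial>leb n) * ennreal (sqrt (2 * pi * s n))"
    by (rule nn_integral_multc[OF meas])
  finally show ?case using Suc.IH Suc.prems by simp
qed

context lc_prob
begin

text \<open>If \<open>g\<close> were below \<tau> everywhere, the expectation of
  \<open>exp (- W x)\<close> would be at most \<tau> times a Gaussian integral, that is exp(-n). By
  Jensen's inequality it is at least exp(-n/2), because \<open>W\<close> has mean at most n/2. The
  slack between the two exponents lets the comparison with \<tau> be non-strict.\<close>

lemma density_sup_ge:
  assumes n: "0 < n" and s: "\<And>i. i < n \<Longrightarrow> 0 < s i"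
    and int: "\<And>c. integrable P (\<lambda>x. (ip n c x)\<^sup>2)"
    and le: "\<And>i. i < n \<Longrightarrow> (\<integral>x. (tri v i x)\<^sup>2 \<partial>P) \<le> s i"
  shows "\<exists>x0\<in>Rn n. exp (- real n) / (\<Prod>i<n. sqrt (2 * pi * s i)) \<le> g x0"
proof (rule ccontr)
  define \<tau> where "\<tau> = exp (- real n) / (\<Prod>i<n. sqrt (2 * pi * s i))"
  have pos: "0 < (\<Prod>i<n. sqrt (2 * pi * s i))" using s by (intro prod_pos) simp
  assume "\<not> (\<exists>x0\<in>Rn n. exp (- real n) / (\<Prod>i<n. sqrt (2 * pi * s i)) \<le> g x0)"
  then have lt: "g x \<le> \<tau>" if "x \<in> Rn n" for x using that by (fastforce simp: \<tau>_def)
  define W where "W x = (\<Sum>i<n. (tri v i x)\<^sup>2 / (2 * s i))" for x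
  have int_tri: "integrable P (\<lambda>x. (tri v i x)\<^sup>2)" if "i < n" for i
    using int[of "tri_coeff v i"] by (simp add: tri_eq_ip[OF that])
  have intW: "integrable P W" unfolding W_def
    by (intro Bochner_Integration.integrable_sum integrable_divide) (simp add: int_tri)
  then have [measurable]: "W \<in> borel_measurable (leb n)" by (auto dest: borel_measurable_integrable)
  have "(\<integral>x. W x \<partial>P) = (\<Sum>i<n. (\<integral>x. (tri v i x)\<^sup>2 \<partial>P) / (2 * s i))"
    unfolding W_def using int_tri by (subst Bochner_Integration.integral_sum) auto
  also have "\<dots> \<le> (\<Sum>i<n. 1 / 2)"
  proof (rule sum_mono)
    fix i assume "i \<in> {..<n}"
    then show "(\<integral>x. (tri v i x)\<^sup>2 \<partial>P) / (2 * s i) \<le> 1 / 2" using s[of i] le[of i] by (simp add: field_simps)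
  qed
  finally have EW: "(\<integral>x. W x \<partial>P) \<le> real n / 2" by simp
  have W0: "0 \<le> W x" for x unfolding W_def using s by (intro sum_nonneg) (simp add: less_imp_le)
  have int_exp: "integrable P (\<lambda>x. exp (- W x))"
    using W0 by (intro integrable_const_bound[where B = 1]) auto
  \<comment> \<open>Jensen's inequality by hand: \<open>exp (- W x)\<close> lies above its tangent
    line, as a function of \<open>W x\<close>, at n/2.\<close>
  have "exp (- real n / 2) \<le> exp (- real n / 2) * (1 + real n / 2 - (\<integral>x. W x \<partial>P))" using EW by simp
  also have "\<dots> = (\<integral>x. exp (- real n / 2) * (1 + real n / 2 - W x) \<partial>P)"
    using intW by simp
  also have "\<dots> \<le> (\<integral>x. exp (- W x) \<partial>P)"
  proof (rule integral_mono)
    fix x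
    have "exp (- real n / 2) * (1 + real n / 2 - W x) \<le> exp (- real n / 2) * exp (real n / 2 - W x)"
      using exp_ge_add_one_self[of "real n / 2 - W x"] by (intro mult_left_mono) (simp_all add: algebra_simps)
    also have "\<dots> = exp (- W x)" by (simp flip: exp_add)
    finally show "exp (- real n / 2) * (1 + real n / 2 - W x) \<le> exp (- W x)" .
  qed (use intW int_exp in auto)
  finally have low: "exp (- real n / 2) \<le> (\<integral>x. exp (- W x) \<partial>P)" .
  have prod: "ennreal (exp (- W x)) = (\<Prod>i<n. ennreal (exp (- (tri v i x)\<^sup>2 / (2 * s i))))" for x
    by (simp add: W_def prod_ennreal sum_negf[symmetric] exp_sum)
  have "ennreal (\<integral>x. exp (- W x) \<partial>P) = (\<integral>\<^sup>+x. ennreal (exp (- W x)) \<partial>P)"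
    using int_exp by (intro nn_integral_eq_integral[symmetric]) auto
  also have "\<dots> = (\<integral>\<^sup>+x. ennreal (g x) * ennreal (exp (- W x)) \<partial>leb n)"
    unfolding P_density by (rule nn_integral_density) measurable
  also have "\<dots> \<le> (\<integral>\<^sup>+x. ennreal \<tau> * ennreal (exp (- W x)) \<partial>leb n)"
    using lt by (intro nn_integral_mono mult_right_mono ennreal_leI) (simp_all add: space_leb)
  also have "\<dots> = ennreal \<tau> * (\<integral>\<^sup>+x. ennreal (exp (- W x)) \<partial>leb n)"
    by (rule nn_integral_cmult) measurable
  also have "(\<integral>\<^sup>+x. ennreal (exp (- W x)) \<partial>leb n) = ennreal (\<Prod>i<n. sqrt (2 * pi * s i))"
  proof -
    have "(\<integral>\<^sup>+x. ennreal (exp (- W x)) \<partial>leb n) = (\<Prod>i<n. ennreal (sqrt (2 * pi * s i)))"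
      unfolding prod by (rule nn_integral_triangular_gaussian) (rule s)
    also have "\<dots> = ennreal (\<Prod>i<n. sqrt (2 * pi * s i))"
      using s by (intro prod_ennreal) (simp add: less_imp_le)
    finally show ?thesis .
  qed
  also have "ennreal \<tau> * \<dots> = ennreal (exp (- real n))"
  proof -
    have "a / p * p = a" if "0 < p" for a p :: real using that by simp
    from this[OF pos] have "\<tau> * (\<Prod>i<n. sqrt (2 * pi * s i)) = exp (- real n)" unfolding \<tau>_def .
    then show ?thesis by (simp only: ennreal_mult'[OF less_imp_le[OF pos], symmetric] mult.commute[of \<tau>] mult.commute[of "ennreal \<tau>"])
  qed
  finally have "(\<integral>x. exp (- W x) \<partial>P) \<le> exp (- real n)" by simp
  with low have "exp (- real n / 2) \<le> exp (- real n)" by linarith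
  then show False using n by simp
qed

end

section \<open>The covariance determinant as a product of residual variances\<close>

context lc_bounded
begin

lemma coord_mult_integrable:
  assumes "i < n" "j < n"
  shows "integrable P (\<lambda>x. x i * x j)"
proof (rule Bochner_Integration.integrable_bound)
  show "integrable P (\<lambda>x. (x i)\<^sup>2 + (x j)\<^sup>2)" using assms coord_square_integrable by simp
  note [measurable] = measurable_coord[OF assms(1)] measurable_coord[OF assms(2)]
  show "(\<lambda>x. x i * x j) \<in> borel_measurable P" by measurable
  have "\<bar>a * b\<bar> \<le> a\<^sup>2 + b\<^sup>2" for a b :: real
  proof -
    have "2 * (\<bar>a\<bar> * \<bar>b\<bar>) \<le> a\<^sup>2 + b\<^sup>2" using zero_le_power2[of "\<bar>a\<bar> - \<bar>b\<bar>"] by (simp add: power2_diff)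
    moreover have "0 \<le> \<bar>a\<bar> * \<bar>b\<bar>" by simp
    ultimately show ?thesis unfolding abs_mult by linarith
  qed
  then show "AE x in P. norm (x i * x j) \<le> norm ((x i)\<^sup>2 + (x j)\<^sup>2)" by (intro AE_I2) simp
qed

lemma ip_square: "(ip n c x)\<^sup>2 = (\<Sum>i<n. \<Sum>j<n. c i * c j * (x i * x j))"
  unfolding ip_def power2_eq_square sum_product by (intro sum.cong refl) (simp add: mult_ac)

lemma ip_square_integrable: "integrable P (\<lambda>x. (ip n c x)\<^sup>2)"
  unfolding ip_square by (intro Bochner_Integration.integrable_sum integrable_mult_right coord_mult_integrable) auto

lemma ip_square_integral: "(\<integral>x. (ip n c x)\<^sup>2 \<partial>P) = (\<Sum>i<n. \<Sum>j<n. c i * c j * (\<integral>x. x i * x j \<partial>P))"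
proof -
  have *: "integrable P (\<lambda>x. c i * c j * (x i * x j))" if "i \<in> {..<n}" "j \<in> {..<n}" for i j
    using that by (intro integrable_mult_right coord_mult_integrable) auto
  have "(\<integral>x. (ip n c x)\<^sup>2 \<partial>P) = (\<Sum>i<n. \<integral>x. (\<Sum>j<n. c i * c j * (x i * x j)) \<partial>P)"
    unfolding ip_square by (intro Bochner_Integration.integral_sum Bochner_Integration.integrable_sum *)
  also have "\<dots> = (\<Sum>i<n. \<Sum>j<n. \<integral>x. c i * c j * (x i * x j) \<partial>P)"
    by (intro sum.cong refl Bochner_Integration.integral_sum *)
  finally show ?thesis by simp
qed

text \<open>Otherwise the linear form vanishes almost surely and the measure lives on a hyperplane,
  which the nondegeneracy clause of \<open>log_concave\<close> forbids.\<close>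

lemma ip_square_pos:
  assumes "k < n" "c k \<noteq> 0"
  shows "0 < (\<integral>x. (ip n c x)\<^sup>2 \<partial>P)"
proof (rule ccontr)
  \<comment> \<open>Normals of hyperplanes have to be extensional; cutting \<open>c\<close> down to
    its first \<open>n\<close> values does not change the linear form.\<close>
  define c' where "c' = restrict c {..<n}"
  have ip: "ip n c' x = ip n c x" for x by (simp add: ip_def c'_def)
  assume "\<not> 0 < (\<integral>x. (ip n c x)\<^sup>2 \<partial>P)"
  moreover have "0 \<le> (\<integral>x. (ip n c x)\<^sup>2 \<partial>P)" by simp
  ultimately have "(\<integral>x. (ip n c x)\<^sup>2 \<partial>P) = 0" by linarith
  then have "AE x in P. (ip n c x)\<^sup>2 = 0"
    using integral_nonneg_eq_0_iff_AE[OF ip_square_integrable, of c] by simp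
  then have ae: "AE x in P. ip n c' x = 0" by (simp add: ip)
  have H: "{y \<in> Rn n. ip n c' y = 0} \<in> sets P" unfolding sets_P space_leb[symmetric] by measurable
  have "measure P {y \<in> Rn n. ip n c' y = 0} = 1"
    using prob_Collect_eq_1[of "\<lambda>y. ip n c' y = 0"] H ae by simp
  moreover have "{y \<in> Rn n. ip n c' y = 0} \<in> hyperplanes n"
    unfolding hyperplanes_def mem_Collect_eq
  proof (intro exI conjI)
    show "c' \<in> Rn n" by (simp add: c'_def)
    show "k < n" "c' k \<noteq> 0" using assms by (simp_all add: c'_def)
  qed (rule refl)
  then have "measure P {y \<in> Rn n. ip n c' y = 0} < 1"
    using lc[unfolded log_concave_def, THEN conjunct2, THEN conjunct2, THEN conjunct2] by (rule bspec[rotated])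
  ultimately show False by simp
qed

lemma tri_square_pos:
  assumes "i < n"
  shows "0 < (\<integral>x. (tri v i x)\<^sup>2 \<partial>P)"
  unfolding tri_eq_ip[OF assms] by (rule ip_square_pos[OF assms]) (simp add: tri_coeff_def)

text \<open>Row \<open>k\<close> of \<open>v\<close> is the least squares regression of coordinate
  \<open>k\<close> on the previous ones, so its residual variance is the Schur complement of the
  leading minor. Each residual variance is positive, so the minors stay positive and the next
  regression is solvable.\<close>

lemma cov_factorization:
  assumes cent: "centered n P"
  shows "\<exists>v. det (cov_mat n P) = (\<Prod>i<n. \<integral>x. (tri v i x)\<^sup>2 \<partial>P)"
proof -
  define A where "A i j = (\<integral>x. x i * x j \<partial>P)" for i j
  \<comment> \<open>Positivity of the minor is kept as a premise, so that all rows of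
    \<open>v\<close> can be chosen at once before the induction establishes it. Only
    \<open>v k\<close> matters for \<open>tri v k\<close>, hence the quantification over every
    \<open>v\<close> with this row.\<close>
  have step: "\<exists>w. 0 < det (mat k k (\<lambda>(i, j). A i j)) \<longrightarrow> (\<forall>v. v k = w \<longrightarrow>
      det (mat (Suc k) (Suc k) (\<lambda>(i, j). A i j)) = det (mat k k (\<lambda>(i, j). A i j)) * (\<integral>x. (tri v k x)\<^sup>2 \<partial>P))"
    if k: "k < n" for k
  proof (cases "0 < det (mat k k (\<lambda>(i, j). A i j))")
    case True
    then obtain w where w: "\<forall>i<k. (\<Sum>j<k. A i j * w j) = A i k"
      and det: "det (mat (Suc k) (Suc k) (\<lambda>(i, j). A i j)) = det (mat k k (\<lambda>(i, j). A i j)) * (A k k - (\<Sum>j<k. A k j * w j))"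
      using det_bordered[of k A] by auto
    have key: "A k k - (\<Sum>j<k. A k j * w j) = (\<integral>x. (tri v k x)\<^sup>2 \<partial>P)" if v: "v k = w" for v
    proof -
      let ?c = "tri_coeff v k"
      \<comment> \<open>This is the covariance matrix applied to the residual vector. By the normal
        equations its entries below \<open>k\<close> vanish, so pairing it with the residual vector
        again leaves only entry \<open>k\<close>.\<close>
      have inner: "(\<Sum>j<n. ?c j * A i j) = A i k - (\<Sum>j<k. A i j * w j)" for i
      proof -
        have "(\<Sum>j<n. ?c j * A i j) = tri v k (A i)" using tri_eq_ip[OF k, of v "A i"] by (simp add: ip_def)
        then show ?thesis by (simp add: tri_def v mult.commute)
      qed
      have "(\<integral>x. (tri v k x)\<^sup>2 \<partial>P) = (\<Sum>i<n. \<Sum>j<n. ?c i * ?c j * A i j)"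
        unfolding A_def by (simp only: tri_eq_ip[OF k] ip_square_integral)
      also have "\<dots> = (\<Sum>i<n. ?c i * (A i k - (\<Sum>j<k. A i j * w j)))"
        by (simp only: inner[symmetric] sum_distrib_left mult.assoc)
      also have "\<dots> = tri v k (\<lambda>i. A i k - (\<Sum>j<k. A i j * w j))"
        using tri_eq_ip[OF k, of v "\<lambda>i. A i k - (\<Sum>j<k. A i j * w j)"] by (simp add: ip_def)
      also have "\<dots> = A k k - (\<Sum>j<k. A k j * w j)"
        using w by (simp add: tri_def)
      finally show ?thesis by simp
    qed
    show ?thesis
    proof (intro exI impI allI)
      fix v assume "v k = w"
      from key[of v, OF this] det show "det (mat (Suc k) (Suc k) (\<lambda>(i, j). A i j)) = det (mat k k (\<lambda>(i, j). A i j)) * (\<integral>x. (tri v k x)\<^sup>2 \<partial>P)"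
        by simp
    qed
  qed auto
  then have "\<forall>k. \<exists>w. k < n \<longrightarrow> 0 < det (mat k k (\<lambda>(i, j). A i j)) \<longrightarrow> (\<forall>v. v k = w \<longrightarrow>
      det (mat (Suc k) (Suc k) (\<lambda>(i, j). A i j)) = det (mat k k (\<lambda>(i, j). A i j)) * (\<integral>x. (tri v k x)\<^sup>2 \<partial>P))"
    by blast
  from choice[OF this] obtain v where v: "\<And>k. k < n \<Longrightarrow> 0 < det (mat k k (\<lambda>(i, j). A i j)) \<Longrightarrow>
      det (mat (Suc k) (Suc k) (\<lambda>(i, j). A i j)) = det (mat k k (\<lambda>(i, j). A i j)) * (\<integral>x. (tri v k x)\<^sup>2 \<partial>P)"
    by blast
  have "k \<le> n \<Longrightarrow> det (mat k k (\<lambda>(i, j). A i j)) = (\<Prod>i<k. \<integral>x. (tri v i x)\<^sup>2 \<partial>P)" for k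
  proof (induction k)
    case 0
    then show ?case by (simp add: det_dim_zero)
  next
    case (Suc k)
    have "0 < (\<Prod>i<k. \<integral>x. (tri v i x)\<^sup>2 \<partial>P)" using Suc.prems tri_square_pos by (intro prod_pos) simp
    then show ?case using v[of k] Suc by simp
  qed
  moreover have "cov_mat n P = mat n n (\<lambda>(i, j). A i j)"
  proof (rule eq_matI)
    fix i j assume "i < dim_row (mat n n (\<lambda>(i, j). A i j))" "j < dim_col (mat n n (\<lambda>(i, j). A i j))"
    then have ij: "i < n" "j < n" by auto
    then have "barycenter P i = 0" "barycenter P j = 0" using cent by (simp_all add: centered_def barycenter_def)
    then show "cov_mat n P $$ (i, j) = mat n n (\<lambda>(i, j). A i j) $$ (i, j)"
      using ij by (simp add: cov_mat_def A_def)
  qed (simp_all add: cov_mat_def)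
  ultimately show ?thesis by auto
qed

lemma ip_mean:
  assumes "centered n P"
  shows "(\<integral>x. ip n c x \<partial>P) = 0"
proof -
  have "(\<integral>x. ip n c x \<partial>P) = (\<Sum>i<n. \<integral>x. c i * x i \<partial>P)"
    unfolding ip_def using assms by (intro Bochner_Integration.integral_sum) (simp add: centered_def)
  also have "\<dots> = 0" using assms by (simp add: centered_def)
  finally show ?thesis .
qed

end

section \<open>Half-space depth\<close>

lemma depth_le:
  assumes c: "c \<in> Rn n" "i < n" "c i \<noteq> 0" and x: "x \<in> Rn n"
  shows "depth n \<mu> x \<le> measure \<mu> {y \<in> Rn n. ip n c x \<le> ip n c y}"
  unfolding depth_def
proof (rule cInf_lower)
  have H: "{y \<in> Rn n. ip n c x \<le> ip n c y} \<in> halfspaces n"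
    unfolding halfspaces_def mem_Collect_eq using c by (intro exI[of _ c] exI[of _ "ip n c x"] conjI exI[of _ i]) simp_all
  have xH: "x \<in> {y \<in> Rn n. ip n c x \<le> ip n c y}" using x by simp
  show "measure \<mu> {y \<in> Rn n. ip n c x \<le> ip n c y} \<in> {measure \<mu> H |H. H \<in> halfspaces n \<and> x \<in> H}"
    by (rule CollectI, rule exI, rule conjI[OF refl conjI[OF H xH]])
  show "bdd_below {measure \<mu> H |H. H \<in> halfspaces n \<and> x \<in> H}"
    by (rule bdd_belowI[of _ 0]) (use measure_nonneg in blast)
qed

text \<open>Allows the depth as integrand without knowing that it is measurable: a non-integrable
  \<open>f\<close> has integral 0 by convention, which the last assumption covers.\<close>

lemma (in prob_Rn) integral_le_of_bound:
  fixes f h :: "(nat \<Rightarrow> real) \<Rightarrow> real"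
  assumes "\<And>x. x \<in> Rn n \<Longrightarrow> f x \<le> h x" "integrable P h" "0 \<le> (\<integral>x. h x \<partial>P)"
  shows "(\<integral>x. f x \<partial>P) \<le> (\<integral>x. h x \<partial>P)"
proof (cases "integrable P f")
  case True
  then show ?thesis using assms by (intro integral_mono) simp_all
next
  case False
  then show ?thesis using assms(3) by (simp add: not_integrable_integral_eq)
qed

lemma (in prob_Rn) depth_le_1:
  assumes "0 < n" "x \<in> Rn n"
  shows "depth n P x \<le> 1"
proof -
  have "depth n P x \<le> measure P {y \<in> Rn n. ip n (restrict (\<lambda>_. 1) {..<n}) x \<le> ip n (restrict (\<lambda>_. 1) {..<n}) y}"
    using assms by (intro depth_le[of _ _ 0]) simp_all
  also have "\<dots> \<le> 1" by (rule prob_le_1)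
  finally show ?thesis .
qed

section \<open>From level sets of the sum to the integral of the depth\<close>

context lc_bounded
begin

text \<open>Two opposite half-spaces through \<open>x\<close> share a null hyperplane, so one of
  them has mass at most 1/2. A bound strictly below 1 is what settles the case of small n / L^2 in
  the end.\<close>

lemma depth_le_half:
  assumes n: "0 < n" and x: "x \<in> Rn n"
  shows "depth n P x \<le> 1 / 2"
proof -
  define c where "c a = restrict (\<lambda>i. if i = 0 then a else 0) {..<n}" for a :: real
  have c: "c a \<in> Rn n" "c a 0 = a" for a using n by (simp_all add: c_def)
  have ip: "ip n (c a) y = a * y 0" for a y
  proof -
    have "ip n (c a) y = (\<Sum>i\<in>{0}. c a i * y i)"
      unfolding ip_def using n by (intro sum.mono_neutral_right) (auto simp: c_def)
    then show ?thesis by (simp add: c)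
  qed
  let ?U = "{y \<in> Rn n. x 0 \<le> y 0}" and ?V = "{y \<in> Rn n. y 0 \<le> x 0}" and ?H = "{y \<in> Rn n. y 0 = x 0}"
  note [measurable] = measurable_coord[OF n]
  have [measurable]: "?U \<in> sets P" "?V \<in> sets P" "?H \<in> sets P" unfolding sets_P space_leb[symmetric] by measurable
  have U: "depth n P x \<le> measure P ?U" using depth_le[OF c(1) n _ x, of 1 P] by (simp add: ip c)
  have V: "depth n P x \<le> measure P ?V" using depth_le[OF c(1) n _ x, of "-1" P] by (simp add: ip c)
  have eq: "{y \<in> S. a y \<le> b y} \<inter> {y \<in> S. b y \<le> a y} = {y \<in> S. b y = a y}"
    for S and a b :: "(nat \<Rightarrow> real) \<Rightarrow> real" by auto
  have "measure P ?U + measure P ?V = measure P (?U \<union> ?V) + measure P (?U \<inter> ?V)"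
    using measure_Un3[of ?U P ?V] by (simp add: fmeasurable_eq_sets)
  also have "?U \<inter> ?V = ?H" by (rule eq)
  also have "measure P ?H = 0" using coord_hyperplane_null_P[OF n] by (simp add: measure_def)
  also have "measure P (?U \<union> ?V) + 0 \<le> 1" by simp
  finally show ?thesis using U V by linarith
qed

text \<open>The 5 adds the exponent 4 of the level set to the 1 lost in the lower bound for the
  density. In \<open>4 * pi\<close> one factor 2 is Gaussian and the other leaves room for the
  variance of the cube. The second claim compares that lower bound with the upper bound
  \<open>M\<close>; taken at \<open>m = 0\<close> it keeps the isotropic constant away from
  0.\<close>

lemma depth_small_outside:
  assumes n: "0 < n" and cent: "centered n P"
  defines "D \<equiv> det (cov_mat n P)"
  shows "0 < D" and "exp (- real n) / (sqrt (4 * pi * 2 ^ m) ^ n * sqrt D) \<le> M"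
    and "\<exists>K\<in>sets (leb n). emeasure (leb n) K \<le> ennreal (exp (5 * real n) * (sqrt (4 * pi * 2 ^ m) ^ n * sqrt D) / (2 ^ m) ^ n) \<and>
       (\<forall>x\<in>Rn n. x \<notin> K \<longrightarrow> depth n P x \<le> 2 * exp (- real n / 2 ^ m))"
proof -
  obtain v where v: "D = (\<Prod>i<n. \<integral>x. (tri v i x)\<^sup>2 \<partial>P)" using cov_factorization[OF cent] unfolding D_def by blast
  define d where "d i = (\<integral>x. (tri v i x)\<^sup>2 \<partial>P)" for i
  have d: "0 < d i" if "i < n" for i unfolding d_def using that by (rule tri_square_pos)
  show D: "0 < D" unfolding v d_def[symmetric] using d by (intro prod_pos) simp
  define S where "S i = (\<Sum>j<n. \<bar>tri_coeff v i j\<bar>)" for i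
  have S: "0 \<le> S i" for i by (simp add: S_def sum_nonneg)
  \<comment> \<open>So small that smoothing at most doubles each residual variance
    \<open>d i\<close>; only the \<open>n\<close> linear forms \<open>tri v i\<close>
    matter.\<close>
  define r where "r = Min ((\<lambda>i. sqrt (d i) / (1 + S i)) ` {..<n})"
  have ne: "(\<lambda>i. sqrt (d i) / (1 + S i)) ` {..<n} \<noteq> {}" using n by auto
  have r: "0 < r" unfolding r_def
  proof (subst Min_gr_iff)
    show "\<forall>a\<in>(\<lambda>i. sqrt (d i) / (1 + S i)) ` {..<n}. 0 < a"
      using d S by (auto intro!: divide_pos_pos add_pos_nonneg)
  qed (use ne in simp_all)
  have rS: "(r * S i)\<^sup>2 \<le> d i" if i: "i < n" for i
  proof -
    have "r \<le> sqrt (d i) / (1 + S i)" unfolding r_def using i by (intro Min_le) auto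
    then have "r * (1 + S i) \<le> sqrt (d i)" using S[of i] by (simp add: pos_le_divide_eq add_pos_nonneg)
    moreover have "r * S i \<le> r * (1 + S i)" using r by (intro mult_left_mono) simp_all
    ultimately have "r * S i \<le> sqrt (d i)" by linarith
    then have "(r * S i)\<^sup>2 \<le> (sqrt (d i))\<^sup>2" using r S[of i] by (intro power_mono) simp_all
    then show ?thesis using d[OF i] by simp
  qed
  obtain Q g where Q: "lc_prob n Q g M"
    and mom: "\<forall>c. integrable Q (\<lambda>x. (ip n c x)\<^sup>2) \<and> (\<integral>x. ip n c x \<partial>Q) = 0 \<and>
        (\<integral>x. (ip n c x)\<^sup>2 \<partial>Q) \<le> 2 ^ m * ((\<integral>x. (ip n c x)\<^sup>2 \<partial>P) + (r * (\<Sum>i<n. \<bar>c i\<bar>))\<^sup>2)"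
    and half: "\<forall>c t. (measure P {x \<in> Rn n. t \<le> ip n c x} / 2) ^ (2 ^ m) \<le> measure Q {x \<in> Rn n. 2 ^ m * t \<le> ip n c x}"
    using sum_of_copies[OF r ip_square_integrable ip_mean[OF cent], of m] by (elim exE conjE) (rule that)
  interpret Q: lc_prob n Q g M by (rule Q)
  define N :: real where "N = 2 ^ m"
  have N: "0 < N" by (simp add: N_def)
  define T where "T = sqrt (4 * pi * N) ^ n * sqrt D"
  have T: "0 < T" using N D by (simp add: T_def)
  have "\<exists>x0\<in>Rn n. exp (- real n) / (\<Prod>i<n. sqrt (2 * pi * (2 * N * d i))) \<le> g x0"
  proof (rule Q.density_sup_ge[OF n])
    fix i assume i: "i < n"
    show "0 < 2 * N * d i" using N d[OF i] by simp
    have "(\<integral>x. (tri v i x)\<^sup>2 \<partial>Q) \<le> N * (d i + (r * S i)\<^sup>2)"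
      using mom[THEN spec, of "tri_coeff v i"] unfolding d_def S_def N_def tri_eq_ip[OF i] by blast
    also have "\<dots> \<le> N * (d i + d i)" using N rS[OF i] by (intro mult_left_mono add_mono) simp_all
    finally show "(\<integral>x. (tri v i x)\<^sup>2 \<partial>Q) \<le> 2 * N * d i" by simp
  qed (use mom in blast)
  also have "(\<Prod>i<n. sqrt (2 * pi * (2 * N * d i))) = T"
  proof -
    have "(\<Prod>i<n. sqrt (2 * pi * (2 * N * d i))) = (\<Prod>i<n. sqrt (4 * pi * N) * sqrt (d i))"
      by (intro prod.cong refl) (simp add: real_sqrt_mult[symmetric] mult_ac)
    also have "\<dots> = sqrt (4 * pi * N) ^ n * (\<Prod>i<n. sqrt (d i))" by (simp add: prod.distrib)
    also have "(\<Prod>i<n. sqrt (d i)) = sqrt D"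
    proof -
      have "sqrt (\<Prod>i<k. d i) = (\<Prod>i<k. sqrt (d i))" for k
        by (induction k) (simp_all add: real_sqrt_mult)
      then show ?thesis by (simp add: v d_def)
    qed
    finally show ?thesis by (simp add: T_def)
  qed
  finally obtain x0 where x0: "x0 \<in> Rn n" and g0: "exp (- real n) / T \<le> g x0" by blast
  show "exp (- real n) / (sqrt (4 * pi * 2 ^ m) ^ n * sqrt D) \<le> M"
    using g0 Q.g_le[OF x0] unfolding T_def N_def by (rule order_trans)
  have pos: "0 < g x0" using g0 T by (smt (verit) divide_pos_pos exp_gt_zero)
  define K where "K = {x \<in> Rn n. exp (- 4 * real n) * g x0 \<le> g x}"
  note lev = Q.level_set[OF x0 pos, folded K_def]
  \<comment> \<open>\<open>K\<close> shrunk by the factor \<open>N\<close>: the level set as seen by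
    the average instead of the sum.\<close>
  define K' where "K' = {x \<in> Rn n. affv n (\<lambda>_. 0) N x \<in> K}"
  have K'm: "K' \<in> sets (leb n)"
  proof -
    have "affv n (\<lambda>_. 0) N -` K \<inter> space (leb n) \<in> sets (leb n)" by (rule measurable_sets[OF measurable_affv lev(1)])
    moreover have "affv n (\<lambda>_. 0) N -` K \<inter> space (leb n) = K'" unfolding K'_def space_leb by blast
    ultimately show ?thesis by simp
  qed
  show "\<exists>K\<in>sets (leb n). emeasure (leb n) K \<le> ennreal (exp (5 * real n) * (sqrt (4 * pi * 2 ^ m) ^ n * sqrt D) / (2 ^ m) ^ n) \<and>
       (\<forall>x\<in>Rn n. x \<notin> K \<longrightarrow> depth n P x \<le> 2 * exp (- real n / 2 ^ m))"
    unfolding N_def[symmetric] T_def[symmetric]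
  proof (intro bexI[OF _ K'm] conjI ballI impI)
    have "emeasure (leb n) K = (\<integral>\<^sup>+x. indicator K x \<partial>leb n)" using lev(1) by simp
    also have "\<dots> = ennreal (N ^ n) * (\<integral>\<^sup>+x. indicator K (affv n (\<lambda>_. 0) N x) \<partial>leb n)"
      using nn_integral_leb_affine[of "indicator K" n N "\<lambda>_. 0"] lev(1) N by simp
    also have "(\<integral>\<^sup>+x. indicator K (affv n (\<lambda>_. 0) N x) \<partial>leb n) = (\<integral>\<^sup>+x. indicator K' x \<partial>leb n)"
      by (intro nn_integral_cong) (simp add: K'_def space_leb indicator_def)
    also have "\<dots> = emeasure (leb n) K'" using K'm by simp
    finally have eq: "emeasure (leb n) K = ennreal (N ^ n) * emeasure (leb n) K'" .
    have "emeasure (leb n) K' = ennreal (1 / N ^ n) * (ennreal (N ^ n) * emeasure (leb n) K')"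
      using N by (simp add: mult.assoc[symmetric] flip: ennreal_mult')
    also have "\<dots> \<le> ennreal (1 / N ^ n) * ennreal (1 / (exp (- 4 * real n) * g x0))"
      unfolding eq[symmetric] by (intro mult_left_mono lev(2)) simp
    also have "\<dots> = ennreal (1 / N ^ n * (1 / (exp (- 4 * real n) * g x0)))"
      using N by (intro ennreal_mult'[symmetric]) simp
    also have "\<dots> \<le> ennreal (exp (5 * real n) * T / N ^ n)"
    proof (rule ennreal_leI)
      have "1 / (exp (- 4 * real n) * g x0) \<le> 1 / (exp (- 4 * real n) * (exp (- real n) / T))"
        using g0 T pos by (intro divide_left_mono mult_left_mono mult_pos_pos) simp_all
      also have "\<dots> = exp (5 * real n) * T"
      proof -
        have "exp (- 4 * real n) * exp (- real n) * exp (5 * real n) = 1" by (simp flip: exp_add)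
        then show ?thesis using T by (simp add: field_simps)
      qed
      finally have "1 / N ^ n * (1 / (exp (- 4 * real n) * g x0)) \<le> 1 / N ^ n * (exp (5 * real n) * T)"
        using N by (intro mult_left_mono) simp_all
      then show "1 / N ^ n * (1 / (exp (- 4 * real n) * g x0)) \<le> exp (5 * real n) * T / N ^ n" by simp
    qed
    finally show "emeasure (leb n) K' \<le> ennreal (exp (5 * real n) * T / N ^ n)" .
  next
    fix x assume x: "x \<in> Rn n" "x \<notin> K'"
    then have z: "affv n (\<lambda>_. 0) N x \<notin> K" by (simp add: K'_def)
    from lev(4)[OF vec_in_Rn(3) z] obtain c i where c: "c \<in> Rn n" "i < n" "c i \<noteq> 0"
      and sep: "\<forall>y\<in>K. ip n c y < ip n c (affv n (\<lambda>_. 0) N x)" by blast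
    have ipz: "ip n c (affv n (\<lambda>_. 0) N x) = N * ip n c x"
      by (simp add: ip_def sum_distrib_left mult_ac)
    let ?H = "{y \<in> Rn n. ip n c x \<le> ip n c y}"
    have "(measure P ?H / 2) ^ (2 ^ m) \<le> measure Q {y \<in> Rn n. N * ip n c x \<le> ip n c y}"
      using half[THEN spec, THEN spec, of "ip n c x" c] unfolding N_def .
    also have "\<dots> \<le> measure Q (Rn n - K)"
    proof (rule Q.finite_measure_mono)
      show "{y \<in> Rn n. N * ip n c x \<le> ip n c y} \<subseteq> Rn n - K"
      proof
        fix y assume y: "y \<in> {y \<in> Rn n. N * ip n c x \<le> ip n c y}"
        then have "y \<notin> K" using sep ipz by (metis (mono_tags, lifting) mem_Collect_eq not_less)
        then show "y \<in> Rn n - K" using y by simp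
      qed
      show "Rn n - K \<in> sets Q" using sets.compl_sets[OF lev(1)] unfolding Q.sets_P space_leb .
    qed
    also have "\<dots> \<le> exp (- real n)" by (rule lev(3))
    also have "\<dots> = exp (- real n / 2 ^ m) ^ (2 ^ m)" by (simp flip: exp_of_nat_mult)
    \<comment> \<open>The N-th root. The rule cancels an exponent of the form \<open>Suc k\<close>,
      hence \<open>2 ^ m - 1\<close>.\<close>
    finally have "measure P ?H / 2 \<le> exp (- real n / 2 ^ m)"
      by (rule power_le_imp_le_base[of _ "2 ^ m - 1", simplified]) simp
    then have "measure P ?H \<le> 2 * exp (- real n / N)" by (simp add: N_def)
    with depth_le[OF c x(1), of P] show "depth n P x \<le> 2 * exp (- real n / N)" by linarith
  qed
qed

text \<open>The integral splits at the exceptional set: inside, the depth is at most 1 and the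
  \<nu>-mass is tiny; outside, the depth itself is small. The number of copies balances the two
  parts.\<close>

lemma depth_integral:
  assumes n: "0 < n" and cent: "centered n P" and M_eq: "M = dens_sup n P"
    and \<nu>: "prob_Rn n \<nu>" "\<And>A. A \<in> sets (leb n) \<Longrightarrow> emeasure \<nu> A \<le> ennreal M * emeasure (leb n) A"
  shows "(\<integral>x. depth n P x \<partial>\<nu>) \<le> exp (- (1 / (32 * pi * exp 12)) * real n / (iso_const n P)\<^sup>2)"
proof -
  interpret V: prob_Rn n \<nu> by (rule \<nu>(1))
  define D where "D = det (cov_mat n P)"
  define L where "L = iso_const n P"
  \<comment> \<open>The mass bound is the n-th power of exp(5) sqrt(4 pi) L / sqrt N. It is at most
    exp(-n) as soon as N is at least 4 pi exp(12) L^2, that is \<open>C * L\<^sup>2\<close>.\<close>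
  define C where "C = 4 * pi * exp 12"
  have C: "0 < C" by (simp add: C_def)
  have D: "0 < D" unfolding D_def by (rule depth_small_outside(1)[OF n cent])
  have L: "0 < L" unfolding L_def iso_const_def M_eq[symmetric] D_def[symmetric] using M D by simp
  have Ln: "L ^ n = M * sqrt D"
  proof -
    have "L ^ n = (M powr (1 / real n)) ^ n * (D powr (1 / (2 * real n))) ^ n"
      unfolding L_def iso_const_def M_eq[symmetric] D_def[symmetric] by (rule power_mult_distrib)
    also have "(M powr (1 / real n)) ^ n = M" using n M by (simp add: powr_powr flip: powr_realpow)
    also have "(D powr (1 / (2 * real n))) ^ n = D powr (1 / 2)" using n D by (simp add: powr_powr flip: powr_realpow)
    finally show ?thesis using D by (simp add: powr_half_sqrt)
  qed
  \<comment> \<open>A universal lower bound on the isotropic constant. It makes rounding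
    \<open>C * L\<^sup>2\<close> up to a power of two cost at most a factor 2, even when
    \<open>m\<close> is 0, and it gives \<open>u \<le> real n\<close>.\<close>
  have CL: "1 \<le> C * L\<^sup>2"
  proof -
    have "exp (- real n) / (sqrt (4 * pi) ^ n * sqrt D) \<le> M"
      using depth_small_outside(2)[OF n cent, of 0] by (simp add: D_def)
    then have "exp (- real n) \<le> M * (sqrt (4 * pi) ^ n * sqrt D)" using D by (simp add: pos_divide_le_eq)
    then have "exp (- 1) ^ n \<le> (sqrt (4 * pi) * L) ^ n"
      by (simp add: power_mult_distrib Ln mult_ac flip: exp_of_nat_mult)
    then have "exp (- 1) \<le> sqrt (4 * pi) * L" using n L by (simp add: power_mono_iff)
    then have "exp 1 * exp (- 1) \<le> exp 6 * (sqrt (4 * pi) * L)" by (intro mult_mono) simp_all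
    then have "1 \<le> exp 6 * (sqrt (4 * pi) * L)" by (simp flip: exp_add)
    then have "1\<^sup>2 \<le> (exp 6 * (sqrt (4 * pi) * L))\<^sup>2" by (intro power_mono) simp_all
    also have "\<dots> = C * L\<^sup>2"
    proof -
      have "(exp 6)\<^sup>2 = exp (12::real)" by (simp add: power2_eq_square flip: exp_add)
      then show ?thesis by (simp add: C_def power_mult_distrib)
    qed
    finally show ?thesis by simp
  qed
  \<comment> \<open>With this many copies, \<open>\<nu>\<close> gives the exceptional level set mass at most \<open>exp (- n)\<close>.\<close>
  obtain m where m: "C * L\<^sup>2 \<le> 2 ^ m" "2 ^ m \<le> 2 * (C * L\<^sup>2)"
  proof -
    define m where "m = (LEAST m. C * L\<^sup>2 \<le> 2 ^ m)"
    obtain k :: nat where "C * L\<^sup>2 < 2 ^ k" using real_arch_pow[of 2 "C * L\<^sup>2"] by auto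
    then have 1: "C * L\<^sup>2 \<le> 2 ^ m" unfolding m_def by (intro LeastI[of "\<lambda>m. C * L\<^sup>2 \<le> 2 ^ m" k]) simp
    have 2: "2 ^ m \<le> 2 * (C * L\<^sup>2)"
    proof (cases m)
      case 0
      then show ?thesis using CL by simp
    next
      case (Suc m')
      then have "\<not> C * L\<^sup>2 \<le> 2 ^ m'" using not_less_Least[of m' "\<lambda>m. C * L\<^sup>2 \<le> 2 ^ m"] by (simp add: m_def)
      then show ?thesis by (simp add: Suc)
    qed
    show ?thesis using that 1 2 by blast
  qed
  define N :: real where "N = 2 ^ m"
  have N: "0 < N" by (simp add: N_def)
  obtain K where K: "K \<in> sets (leb n)"
    "emeasure (leb n) K \<le> ennreal (exp (5 * real n) * (sqrt (4 * pi * N) ^ n * sqrt D) / N ^ n)"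
    "\<forall>x\<in>Rn n. x \<notin> K \<longrightarrow> depth n P x \<le> 2 * exp (- real n / N)"
    using depth_small_outside(3)[OF n cent, of m] unfolding D_def N_def by blast
  have vK: "measure \<nu> K \<le> exp (- real n)"
  proof -
    have "emeasure \<nu> K \<le> ennreal M * ennreal (exp (5 * real n) * (sqrt (4 * pi * N) ^ n * sqrt D) / N ^ n)"
      by (rule order_trans[OF \<nu>(2)[OF K(1)]]) (intro mult_left_mono K(2), simp)
    also have "\<dots> = ennreal (M * (exp (5 * real n) * (sqrt (4 * pi * N) ^ n * sqrt D) / N ^ n))"
      using M by (intro ennreal_mult'[symmetric]) simp
    finally have "measure \<nu> K \<le> M * (exp (5 * real n) * (sqrt (4 * pi * N) ^ n * sqrt D) / N ^ n)"
      using M D N by (simp add: V.emeasure_eq_measure)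
    also have "\<dots> = (exp 5 * sqrt (4 * pi * N) * L / N) ^ n"
    proof -
      have "exp (5 * real n) = exp 5 ^ n" by (simp add: exp_of_nat2_mult mult.commute flip: exp_of_nat_mult)
      then show ?thesis by (simp add: power_mult_distrib power_divide Ln mult_ac)
    qed
    also have "\<dots> \<le> exp (- 1) ^ n"
    proof (rule power_mono)
      have "sqrt (C * L\<^sup>2) \<le> sqrt N" using m(1) by (simp add: N_def)
      moreover have "sqrt (C * L\<^sup>2) = exp 6 * sqrt (4 * pi) * L"
      proof -
        have "(exp 12 :: real) = (exp 6)\<^sup>2" by (simp add: power2_eq_square flip: exp_add)
        then show ?thesis using L by (simp add: C_def real_sqrt_mult)
      qed
      ultimately have le: "exp 6 * sqrt (4 * pi) * L \<le> sqrt N" by simp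
      have "exp 5 * sqrt (4 * pi * N) * L / N = exp (- 1) * (exp 6 * sqrt (4 * pi) * L) * sqrt N / N"
      proof -
        have "exp (5::real) = exp (- 1) * exp 6" by (simp flip: exp_add)
        then show ?thesis by (simp add: real_sqrt_mult)
      qed
      also have "\<dots> \<le> exp (- 1) * sqrt N * sqrt N / N"
        using N le by (intro divide_right_mono mult_right_mono mult_left_mono) simp_all
      also have "\<dots> = exp (- 1)" using N by (simp only: mult.assoc real_sqrt_mult_self) simp
      finally show "exp 5 * sqrt (4 * pi * N) * L / N \<le> exp (- 1)" .
      show "0 \<le> exp 5 * sqrt (4 * pi * N) * L / N" using N L by simp
    qed
    also have "\<dots> = exp (- real n)" by (simp flip: exp_of_nat_mult)
    finally show ?thesis .
  qed
  \<comment> \<open>A common lower bound for the exponents \<open>real n\<close> and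
    \<open>real n / N\<close>. The final constant has 32 pi exp(12) = 8 C: a 2 from rounding N and a
    4 from absorbing the prefactor 3 of exp(-u).\<close>
  define u where "u = real n / (2 * (C * L\<^sup>2))"
  have goal: "- (1 / (32 * pi * exp 12)) * real n / (iso_const n P)\<^sup>2 = - u / 4"
    by (simp add: u_def C_def L_def)
  have u: "u \<le> real n" "u \<le> real n / N"
  proof -
    show "u \<le> real n / N" unfolding u_def using m(2) N CL by (intro divide_left_mono) (simp_all add: N_def)
    have "u \<le> real n / 1" unfolding u_def using CL by (intro divide_left_mono) simp_all
    then show "u \<le> real n" by simp
  qed
  have b1: "(\<integral>x. depth n P x \<partial>\<nu>) \<le> 3 * exp (- u)"
  proof -
    have int: "integrable \<nu> (\<lambda>x. indicator K x + 2 * exp (- real n / N))"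
      using K(1) by (intro Bochner_Integration.integrable_add) (simp_all add: integrable_indicator_iff V.emeasure_eq_measure)
    have val: "(\<integral>x. indicator K x + 2 * exp (- real n / N) \<partial>\<nu>) = measure \<nu> K + 2 * exp (- real n / N)"
      using K(1) sets.sets_into_space[OF K(1)] unfolding space_leb
      by (subst Bochner_Integration.integral_add) (simp_all add: integrable_indicator_iff V.emeasure_eq_measure Int_absorb2)
    have "(\<integral>x. depth n P x \<partial>\<nu>) \<le> (\<integral>x. indicator K x + 2 * exp (- real n / N) \<partial>\<nu>)"
    proof (rule V.integral_le_of_bound[OF _ int])
      fix x assume x: "x \<in> Rn n"
      show "depth n P x \<le> indicator K x + 2 * exp (- real n / N)"
      proof (cases "x \<in> K")
        case True
        then show ?thesis using depth_le_1[OF n x] by (simp add: indicator_def add_increasing2)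
      next
        case False
        then show ?thesis using K(3) x by (simp add: indicator_def)
      qed
    qed (simp add: val)
    also have "\<dots> \<le> exp (- u) + 2 * exp (- u)"
      unfolding val using vK u by (intro add_mono mult_left_mono order_trans[OF vK]) simp_all
    finally show ?thesis by simp
  qed
  have b2: "(\<integral>x. depth n P x \<partial>\<nu>) \<le> 1 / 2"
    using V.integral_le_of_bound[of "depth n P" "\<lambda>_. 1 / 2"] depth_le_half[OF n] by simp
  \<comment> \<open>For u up to 2 the target exp(-u/4) is at least 1/2, so the trivial depth bound
    suffices. Beyond that, exp(3u/4) exceeds the prefactor 3.\<close>
  show ?thesis unfolding goal
  proof (cases "u \<le> 2")
    case True
    then have "1 / 2 \<le> exp (- u / 4)" using exp_ge_add_one_self[of "- u / 4"] by simp
    with b2 show "(\<integral>x. depth n P x \<partial>\<nu>) \<le> exp (- u / 4)" by simp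
  next
    case False
    have "3 \<le> exp (3 / 2 :: real)" using exp_lower_Taylor_quadratic[of "3 / 2 :: real"] by (simp add: power2_eq_square)
    also have "\<dots> \<le> exp (3 * u / 4)" using False by simp
    finally have "3 * exp (- u) \<le> exp (3 * u / 4) * exp (- u)" by (intro mult_right_mono) simp_all
    also have "\<dots> = exp (- u / 4)" by (simp flip: exp_add)
    finally show "(\<integral>x. depth n P x \<partial>\<nu>) \<le> exp (- u / 4)" using b1 by simp
  qed
qed

end

section \<open>Existence of a bounded density, and conclusion\<close>

lemma prob_Rn_of_log_concave: "log_concave n \<mu> \<Longrightarrow> prob_Rn n \<mu>"
  by (simp add: log_concave_def prob_Rn_def prob_Rn_axioms_def)

text \<open>Positivity of \<open>dens_sup\<close> excludes both default values:
  \<open>RN_deriv\<close> is the zero function when no density exists, and \<open>enn2real\<close>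
  sends an infinite essential supremum to 0.\<close>

lemma dominated_by_dens_sup:
  assumes "0 < dens_sup n \<mu>" and A: "A \<in> sets (leb n)"
  shows "emeasure \<mu> A \<le> ennreal (dens_sup n \<mu>) * emeasure (leb n) A"
proof -
  let ?f = "RN_deriv (leb n) \<mu>" and ?s = "esssup (leb n) (RN_deriv (leb n) \<mu>)"
  have s: "?s = ennreal (dens_sup n \<mu>)"
    using assms(1) unfolding dens_sup_def by (cases ?s) auto
  have ex: "\<exists>f. f \<in> borel_measurable (leb n) \<and> density (leb n) f = \<mu>"
  proof (rule ccontr)
    assume "\<not> ?thesis"
    then have "?f = (\<lambda>_. 0)" unfolding RN_deriv_def by (rule if_not_P)
    then have "?s \<le> 0" by (intro esssup_I) auto
    then show False using assms(1) by (simp add: dens_sup_def)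
  qed
  then have "?f = (SOME f. f \<in> borel_measurable (leb n) \<and> density (leb n) f = \<mu>)"
    unfolding RN_deriv_def by (rule if_P)
  with someI_ex[OF ex] have dens: "density (leb n) ?f = \<mu>" by simp
  have "emeasure \<mu> A = (\<integral>\<^sup>+x. ?f x * indicator A x \<partial>leb n)"
    using A by (subst dens[symmetric]) (rule emeasure_density, simp_all)
  also have "\<dots> \<le> (\<integral>\<^sup>+x. ?s * indicator A x \<partial>leb n)"
    using esssup_AE[of ?f "leb n"] by (intro nn_integral_mono_AE) (auto simp: indicator_def)
  also have "\<dots> = ?s * emeasure (leb n) A" using A by (rule nn_integral_cmult_indicator)
  finally show ?thesis unfolding s .
qed

theorem theorem3p2:
  shows "\<exists>c::real. c > 0 \<and> (\<exists>n0::nat. \<forall>n \<ge> n0. \<forall>\<mu> \<nu>.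
     log_concave n \<mu> \<and> centered n \<mu> \<and> log_concave n \<nu> \<and> centered n \<nu> \<and>
     dens_sup n \<mu> = dens_sup n \<nu> \<longrightarrow>
     (\<integral>x. depth n \<mu> x \<partial>\<nu>) \<le> exp (- c * real n / (iso_const n \<mu>)\<^sup>2))"
proof (intro exI[of _ "1 / (32 * pi * exp 12)"] conjI exI[of _ 1] allI impI; (elim conjE)?)
  show "0 < 1 / (32 * pi * exp 12)" by simp
  fix n :: nat and \<mu> \<nu>
  assume n: "1 \<le> n" and \<mu>: "log_concave n \<mu>" "centered n \<mu>" and \<nu>: "log_concave n \<nu>"
    and eq: "dens_sup n \<mu> = dens_sup n \<nu>"
  interpret M: prob_Rn n \<mu> by (rule prob_Rn_of_log_concave[OF \<mu>(1)])
  interpret V: prob_Rn n \<nu> by (rule prob_Rn_of_log_concave[OF \<nu>])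
  show "(\<integral>x. depth n \<mu> x \<partial>\<nu>) \<le> exp (- (1 / (32 * pi * exp 12)) * real n / (iso_const n \<mu>)\<^sup>2)"
  proof (cases "dens_sup n \<mu> = 0")
    case True
    \<comment> \<open>This covers measures without a (bounded) density: then the bound is \<open>exp 0\<close>, as division by zero gives zero.\<close>
    then have "iso_const n \<mu> = 0" by (simp add: iso_const_def)
    then show ?thesis
      using V.integral_le_of_bound[of "depth n \<mu>" "\<lambda>_. 1"] M.depth_le_1 n by simp
  next
    case False
    then have pos: "0 < dens_sup n \<mu>" by (simp add: dens_sup_def order.strict_iff_order)
    interpret lc_bounded n \<mu> "dens_sup n \<mu>"
      by unfold_locales (use \<mu> pos dominated_by_dens_sup in auto)
    \<comment> \<open>Equality of the two density maxima lets \<nu> be dominated by the same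
      constant that enters the isotropic constant of \<mu>.\<close>
    show ?thesis
      using n \<mu>(2) pos dominated_by_dens_sup[of n \<nu>]
      by (intro depth_integral refl V.prob_Rn_axioms) (simp_all add: eq)
  qed
qed

end
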